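(* Let $\Bbbk$ be a field and $G$ a finite group. Let $R=(u,r,p,v)$ and $R'=(u',r',p',v')$ be quasitriangular structures of $\mathcal D(G)$, and let $X=\begin{pmatrix}\alpha&\beta\\ \gamma&\delta\end{pmatrix}\in\operatorname{Aut}(\mathcal D(G))$. Then the following are equivalent: (1) $(X\otimes X)(R)=R'$; (2) $X\circ(F(R)\circ X^* )=F(R')$; (3) the following four identities all hold, where addition denotes convolution product: $$u'=\alpha r\gamma^*+\alpha u\delta^*+\beta p\delta^*+\beta v\gamma^*,$$ $$r'=\alpha r\alpha^*+\alpha u\beta^*+\beta p\beta^*+\beta v\alpha^*,$$ $$p'=\gamma r\gamma^*+\gamma u\delta^*+\delta p\delta^*+\delta v\gamma^*,$$ $$v'=\gamma r\alpha^*+\gamma u\beta^*+\delta p\beta^*+\delta v\alpha^*.$$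
   Context: Double. $\Bbbk^G$ is the algebra of functions $G\to\Bbbk$ with basis $e_g$ ($e_g(h)=\delta_{g,h}$) and unit $1=\varepsilon=\sum_g e_g$; $\Bbbk^{G\,\mathrm{co}}$ is the Hopf algebra $\Bbbk^G$ with opposite coproduct, $\Delta(e_x)=\sum_{s\in G}e_s\otimes e_{xs^{-1}}$. $G$ acts by conjugation: $g\rightharpoonup e_x=e_{gxg^{-1}}$. $\mathcal D(G)$ is $\Bbbk^{G\,\mathrm{co}}\otimes\Bbbk G$ as a coalgebra, with elements $f\bowtie g$ and product $(f\bowtie g)(f'\bowtie g')=f(g\rightharpoonup f')\bowtie gg'$. $\widehat G=\operatorname{Hom}(G,\Bbbk^\times)\subset\Bbbk^G$. Quasitriangular structures. For a Hopf algebra $H$ with flip $\tau$, a quasitriangular structure is $R\in H\otimes H$ with $(\Delta\otimes\mathrm{id})(R)=R^{13}R^{23}$, $(\mathrm{id}\otimes\Delta)(R)=R^{13}R^{12}$, $(\varepsilon\otimes\mathrm{id})(R)=1=(\mathrm{id}\otimes\varepsilon)(R)$ (such $R$ is invertible) and $R\Delta(h)=\tau(\Delta(h))R$ for all $h\in H$. Components. Let $f\# g\in\mathcal D(G)^*$ be the functional $e_s\bowtie h\mapsto\delta_{s,g}f(h)$, and for $R\in\mathcal D(G)\otimes\mathcal D(G)$ let $F(R):\mathcal D(G)^*\to\mathcal D(G)$, $F(R)(\phi)=(\phi\otimes\mathrm{id})(R)$. Write $R=(u,r,p,v)$, where, with $(\mathrm{id}\otimes\varepsilon)(f\bowtie g)=f$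 and $(\mathrm{ev}_1\otimes\mathrm{id})(f\bowtie g)=f(1)g$: $u(f)=(\mathrm{id}\otimes\varepsilon)F(R)(f\#1)$, $r(g)=(\mathrm{id}\otimes\varepsilon)F(R)(\varepsilon\# g)$, $p(f)=(\mathrm{ev}_1\otimes\mathrm{id})F(R)(f\#1)$, $v(g)=(\mathrm{ev}_1\otimes\mathrm{id})F(R)(\varepsilon\# g)$. Thus $u:\Bbbk^G\to\Bbbk^G$, $r:\Bbbk G\to\Bbbk^G$, $p:\Bbbk^G\to\Bbbk G$, $v:\Bbbk G\to\Bbbk G$ as linear maps. Automorphisms. It is known that every Hopf algebra automorphism $X$ of $\mathcal D(G)$ is written uniquely as a matrix $\begin{pmatrix}\alpha&\beta\\ \gamma&\delta\end{pmatrix}$, meaning $X(f\bowtie x)=\beta(x)\alpha(f_{(1)})\bowtie\gamma(f_{(2)})\delta(x)$, where $\alpha:\Bbbk^G\to\Bbbk^G$ is a Hopf algebra map (so its transpose $\alpha^*$ is an endomorphism of $G$), $\beta\in\operatorname{Hom}(G,\widehat G)$ (extended linearly to $\Bbbk G\to\Bbbk^G$), $\delta\in\operatorname{End}(G)$ (extended linearly to $\Bbbk G\to\Bbbk G$), and $\gamma:\Bbbk^G\to\Bbbk G$ is a Hopf algebra map which is the composite of the restriction to a central subgroup $\Bbbk^G\to\Bbbk^{A'}$, an isomorphism $\Bbbk^{A'}\cong\Bbbk B'$, and the inclusion of $\Bbbk B'$ with $B'$ central. A superscript $*$ denotes the linear transpose: $\alpha^*:\Bbbk G\to\Bbbk G$,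 $\beta^*:\Bbbk G\to\Bbbk^G$, $\gamma^*:\Bbbk^G\to\Bbbk G$, $\delta^*:\Bbbk^G\to\Bbbk^G$, and $X^*:\mathcal D(G)^*\to\mathcal D(G)^*$, which is $X^*(f\# s)=\beta^*(s)\delta^*(f_{(1)})\#\gamma^*(f_{(2)})\alpha^*(s)$. Juxtaposition of maps is composition; the convolution product of linear maps from a coalgebra to an algebra is $(\phi+\psi)(c)=\phi(c_{(1)})\psi(c_{(2)})$ (with the coproduct of $\Bbbk^{G\,\mathrm{co}}$, respectively with group elements grouplike). *)

theory Defs
  imports Complex_Main "HOL-Library.Function_Algebras"
begin

section \<open>Vector spaces with a chosen finite basis\<close>

text \<open>
  The finite-dimensional vector space with basis indexed by a finite type \<open>'b\<close> is
  \<open>'b \<Rightarrow> 'k\<close>, an element being given by its coefficients. Tensor products are spaces over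
  product types, and the linear dual is again \<open>'b \<Rightarrow> 'k\<close>: a functional is
  given by its values on the basis. Sums \<open>+\<close> of functions are pointwise.
\<close>

definition scale :: "'k::field \<Rightarrow> ('b \<Rightarrow> 'k) \<Rightarrow> 'b \<Rightarrow> 'k"
  where "scale c f = (\<lambda>b. c * f b)"

definition is_linear :: "(('b \<Rightarrow> 'k::field) \<Rightarrow> ('c \<Rightarrow> 'k)) \<Rightarrow> bool"
  where "is_linear \<phi> \<longleftrightarrow> Vector_Spaces.linear scale scale \<phi>"

definition bas :: "'b \<Rightarrow> 'b \<Rightarrow> 'k::field"
  where "bas b = (\<lambda>c. if c = b then 1 else 0)"

definition lin_ext :: "('b::finite \<Rightarrow> 'c \<Rightarrow> 'k::field) \<Rightarrow> ('b \<Rightarrow> 'k) \<Rightarrow> ('c \<Rightarrow> 'k)"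
  where "lin_ext \<phi> f = (\<Sum>b\<in>UNIV. scale (f b) (\<phi> b))"

definition bilin_ext ::
  "('b::finite \<Rightarrow> 'c::finite \<Rightarrow> 'd \<Rightarrow> 'k::field) \<Rightarrow> ('b \<Rightarrow> 'k) \<Rightarrow> ('c \<Rightarrow> 'k) \<Rightarrow> ('d \<Rightarrow> 'k)"
  where "bilin_ext \<phi> f g = (\<Sum>b\<in>UNIV. \<Sum>c\<in>UNIV. scale (f b * g c) (\<phi> b c))"

definition tensor :: "('b \<Rightarrow> 'k::field) \<Rightarrow> ('c \<Rightarrow> 'k) \<Rightarrow> ('b \<times> 'c \<Rightarrow> 'k)"  (infixr \<open>\<otimes>\<close> 70)
  where "f \<otimes> g = (\<lambda>(b, c). f b * g c)"

definition tensor_map ::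
  "(('b::finite \<Rightarrow> 'k::field) \<Rightarrow> ('c \<Rightarrow> 'k)) \<Rightarrow> (('d::finite \<Rightarrow> 'k) \<Rightarrow> ('e \<Rightarrow> 'k)) \<Rightarrow>
    ('b \<times> 'd \<Rightarrow> 'k) \<Rightarrow> ('c \<times> 'e \<Rightarrow> 'k)"
  where "tensor_map \<phi> \<psi> = lin_ext (\<lambda>(b, d). \<phi> (bas b) \<otimes> \<psi> (bas d))"

definition flip :: "('b \<times> 'c \<Rightarrow> 'k) \<Rightarrow> ('c \<times> 'b \<Rightarrow> 'k)"
  where "flip T = (\<lambda>(c, b). T (b, c))"

definition assoc_tensor :: "(('b \<times> 'c) \<times> 'd \<Rightarrow> 'k) \<Rightarrow> ('b \<times> 'c \<times> 'd \<Rightarrow> 'k)"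
  where "assoc_tensor T = (\<lambda>(b, c, d). T ((b, c), d))"

text \<open>
  The linear transpose of \<open>M\<close> sends a functional \<open>\<xi>\<close> to \<open>\<xi> \<circ> M\<close>. In coordinates this identifies
  \<open>\<Bbbk>G\<close> and \<open>\<Bbbk>\<^sup>G\<close> as each other's dual, with \<open>bas g\<close> and \<open>e\<^sub>g\<close> dual bases.
\<close>
definition lin_transpose :: "(('b \<Rightarrow> 'k::field) \<Rightarrow> ('c::finite \<Rightarrow> 'k)) \<Rightarrow> ('c \<Rightarrow> 'k) \<Rightarrow> ('b \<Rightarrow> 'k)"
  where "lin_transpose M \<xi> = (\<lambda>b. \<Sum>c\<in>UNIV. \<xi> c * M (bas b) c)"


section \<open>Hopf algebras and quasitriangular structures\<close>

text \<open>
  The record has no antipode: an antipode is determined by the bialgebra structure, and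
  bialgebra maps between Hopf algebras preserve it.
\<close>
record ('b, 'k) hopf =
  hmul :: "('b \<Rightarrow> 'k) \<Rightarrow> ('b \<Rightarrow> 'k) \<Rightarrow> ('b \<Rightarrow> 'k)"
  hunit :: "'b \<Rightarrow> 'k"
  hcomul :: "('b \<Rightarrow> 'k) \<Rightarrow> ('b \<times> 'b \<Rightarrow> 'k)"
  hcounit :: "('b \<Rightarrow> 'k) \<Rightarrow> 'k"

definition hopf_hom ::
  "('b::finite, 'k::field) hopf \<Rightarrow> ('c::finite, 'k) hopf \<Rightarrow> (('b \<Rightarrow> 'k) \<Rightarrow> ('c \<Rightarrow> 'k)) \<Rightarrow> bool"
  where "hopf_hom H K \<phi> \<longleftrightarrow> is_linear \<phi> \<and>
    (\<forall>a b. \<phi> (hmul H a b) = hmul K (\<phi> a) (\<phi> b)) \<and> \<phi> (hunit H) = hunit K \<and>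
    (\<forall>a. hcomul K (\<phi> a) = tensor_map \<phi> \<phi> (hcomul H a)) \<and> (\<forall>a. hcounit K (\<phi> a) = hcounit H a)"

definition hopf_aut :: "('b::finite, 'k::field) hopf \<Rightarrow> (('b \<Rightarrow> 'k) \<Rightarrow> ('b \<Rightarrow> 'k)) \<Rightarrow> bool"
  where "hopf_aut H \<phi> \<longleftrightarrow> hopf_hom H H \<phi> \<and> bij \<phi>"

text \<open>\<open>\<phi> \<boxplus>\<^bsub>C,A\<^esub> \<psi>\<close> is \<open>c \<mapsto> \<phi>(c\<^sub>1) \<psi>(c\<^sub>2)\<close>, with the coproduct of \<open>C\<close> and the product of \<open>A\<close>.\<close>
definition convolution ::
  "(('b::finite \<Rightarrow> 'k::field) \<Rightarrow> ('c \<Rightarrow> 'k)) \<Rightarrow> ('b, 'k) hopf \<Rightarrow> ('c, 'k) hopf \<Rightarrow>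
    (('b \<Rightarrow> 'k) \<Rightarrow> ('c \<Rightarrow> 'k)) \<Rightarrow> ('b \<Rightarrow> 'k) \<Rightarrow> ('c \<Rightarrow> 'k)"
    (\<open>(_ \<boxplus>\<^bsub>_,_\<^esub> _)\<close> [50, 0, 0, 51] 50)
  where "\<phi> \<boxplus>\<^bsub>C,A\<^esub> \<psi> =
    (\<lambda>c. lin_ext (\<lambda>(i, j). hmul A (\<phi> (bas i)) (\<psi> (bas j))) (hcomul C c))"

definition tensor_mul ::
  "(('b::finite \<Rightarrow> 'k::field) \<Rightarrow> ('b \<Rightarrow> 'k) \<Rightarrow> ('b \<Rightarrow> 'k)) \<Rightarrow>
    (('c::finite \<Rightarrow> 'k) \<Rightarrow> ('c \<Rightarrow> 'k) \<Rightarrow> ('c \<Rightarrow> 'k)) \<Rightarrow>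
    ('b \<times> 'c \<Rightarrow> 'k) \<Rightarrow> ('b \<times> 'c \<Rightarrow> 'k) \<Rightarrow> ('b \<times> 'c \<Rightarrow> 'k)"
  where "tensor_mul m n = bilin_ext (\<lambda>(b, c) (b', c'). m (bas b) (bas b') \<otimes> n (bas c) (bas c'))"

definition leg12 :: "('b, 'k::field) hopf \<Rightarrow> ('b \<times> 'b \<Rightarrow> 'k) \<Rightarrow> ('b \<times> 'b \<times> 'b \<Rightarrow> 'k)"
  where "leg12 H R = (\<lambda>(i, j, k). R (i, j) * hunit H k)"

definition leg13 :: "('b, 'k::field) hopf \<Rightarrow> ('b \<times> 'b \<Rightarrow> 'k) \<Rightarrow> ('b \<times> 'b \<times> 'b \<Rightarrow> 'k)"
  where "leg13 H R = (\<lambda>(i, j, k). R (i, k) * hunit H j)"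

definition leg23 :: "('b, 'k::field) hopf \<Rightarrow> ('b \<times> 'b \<Rightarrow> 'k) \<Rightarrow> ('b \<times> 'b \<times> 'b \<Rightarrow> 'k)"
  where "leg23 H R = (\<lambda>(i, j, k). R (j, k) * hunit H i)"

definition quasitriangular :: "('b::finite, 'k::field) hopf \<Rightarrow> ('b \<times> 'b \<Rightarrow> 'k) \<Rightarrow> bool"
  where "quasitriangular H R \<longleftrightarrow>
    (let mul2 = tensor_mul (hmul H) (hmul H); mul3 = tensor_mul (hmul H) mul2 in
      assoc_tensor (tensor_map (hcomul H) id R) = mul3 (leg13 H R) (leg23 H R) \<and>
      tensor_map id (hcomul H) R = mul3 (leg13 H R) (leg12 H R) \<and>
      (\<lambda>j. \<Sum>i\<in>UNIV. hcounit H (bas i) * R (i, j)) = hunit H \<and>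
      (\<lambda>i. \<Sum>j\<in>UNIV. R (i, j) * hcounit H (bas j)) = hunit H \<and>
      (\<forall>h. mul2 R (hcomul H h) = mul2 (flip (hcomul H h)) R))"

text \<open>\<open>F(R)(\<phi>) = (\<phi> \<otimes> id)(R)\<close>, the functional \<open>\<phi>\<close> being given by its values on the basis.\<close>
definition F_map :: "('b::finite \<times> 'b \<Rightarrow> 'k::field) \<Rightarrow> ('b \<Rightarrow> 'k) \<Rightarrow> ('b \<Rightarrow> 'k)"
  where "F_map R \<phi> = (\<lambda>j. \<Sum>i\<in>UNIV. \<phi> i * R (i, j))"


section \<open>The double of a finite group\<close>

text \<open>
  The finite group is a type of class \<open>group_add\<close>, which is not assumed commutative: \<open>x + y\<close>,
  \<open>0\<close>, \<open>- x\<close>, \<open>x - y\<close> stand for \<open>x y\<close>, \<open>1\<close>, \<open>x\<^sup>-\<^sup>1\<close>, \<open>x y\<^sup>-\<^sup>1\<close>. Both \<open>\<Bbbk>\<^sup>G\<close> and \<open>\<Bbbk>G\<close> have underlying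
  space \<open>'g \<Rightarrow> 'k\<close>; \<open>bas x\<close> is \<open>e\<^sub>x\<close> in the former and \<open>x\<close> in the latter. The product \<open>*\<close> and the
  unit \<open>1\<close> of functions are pointwise, hence those of \<open>\<Bbbk>\<^sup>G\<close> and never those of \<open>\<Bbbk>G\<close>.
\<close>

definition fun_co :: "('g::{finite,group_add}, 'k::field) hopf"
  where "fun_co = \<lparr>
    hmul = (*),
    hunit = 1,
    hcomul = lin_ext (\<lambda>x. \<Sum>s\<in>UNIV. bas s \<otimes> bas (x - s)),
    hcounit = (\<lambda>f. f 0)\<rparr>"

definition grp_alg :: "('g::{finite,group_add}, 'k::field) hopf"
  where "grp_alg = \<lparr>
    hmul = bilin_ext (\<lambda>x y. bas (x + y)),
    hunit = bas 0,
    hcomul = lin_ext (\<lambda>x. bas x \<otimes> bas x),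
    hcounit = (\<lambda>z. \<Sum>x\<in>UNIV. z x)\<rparr>"

definition conj_act :: "'g::group_add \<Rightarrow> ('g \<Rightarrow> 'k) \<Rightarrow> ('g \<Rightarrow> 'k)"
  where "conj_act g f = (\<lambda>y. f (- g + y + g))"

lemma conj_act_bas: "conj_act g (bas x) = bas (g + x - g)"
proof -
  have "- g + y + g = x \<longleftrightarrow> y = g + x - g" for y
    by (metis add.assoc add_diff_cancel diff_add_cancel minus_add_cancel add_minus_cancel)
  then show ?thesis by (simp add: conj_act_def bas_def fun_eq_iff)
qed

text \<open>\<open>f \<otimes> z\<close> is \<open>f \<bowtie> z\<close>; the basis element \<open>bas (s, g)\<close> is \<open>e\<^sub>s \<bowtie> g\<close>.\<close>
definition double :: "('g::{finite,group_add} \<times> 'g, 'k::field) hopf"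
  where "double = \<lparr>
    hmul = bilin_ext (\<lambda>(s, g) (t, h). (bas s * conj_act g (bas t)) \<otimes> bas (g + h)),
    hunit = 1 \<otimes> bas 0,
    hcomul = lin_ext (\<lambda>(x, g). \<Sum>s\<in>UNIV. bas (s, g) \<otimes> bas (x - s, g)),
    hcounit = (\<lambda>a. \<Sum>g\<in>UNIV. a (0, g))\<rparr>"

lemma sum_fun_apply: "(\<Sum>i\<in>A. f i) x = (\<Sum>i\<in>A. f i x)" for f :: "'a \<Rightarrow> 'b \<Rightarrow> 'k::field"
  by (induction A rule: infinite_finite_induct) auto

lemma sum_UNIV_prod:
  "(\<Sum>p\<in>(UNIV::('a::finite \<times> 'b::finite) set). F p) = (\<Sum>s\<in>UNIV. \<Sum>h\<in>UNIV. F (s, h))"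
  by (simp add: sum.cartesian_product flip: UNIV_Times_UNIV)

lemma if_mult_0:
  "(if P then a else 0) * c = (if P then a * c else 0)"
  "c * (if P then a else 0) = (if P then c * a else (0::'k::field))"
  by auto

lemma sum_if_0:
  "(\<Sum>x\<in>A. if P then f x else 0) = (if P then \<Sum>x\<in>A. f x else (0::'k::field))"
  by simp

lemma double_mul_bowtie:
  "hmul double (f \<otimes> bas g) (f' \<otimes> bas g') = (f * conj_act g f') \<otimes> bas (g + g')"
proof (rule ext, clarify)
  fix a b :: 'a
  show "hmul double (f \<otimes> bas g) (f' \<otimes> bas g') (a, b) = ((f * conj_act g f') \<otimes> bas (g + g')) (a, b)"
    unfolding double_def bilin_ext_def sum_UNIV_prod
    by (simp add: sum_fun_apply tensor_def bas_def conj_act_def scale_def if_mult_0 sum_if_0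
        cong: if_cong)
qed

text \<open>
  The functional \<open>e\<^sub>s \<bowtie> h \<mapsto> \<delta>\<^sub>s\<^sub>,\<^sub>g f(h)\<close>, extended linearly from group elements \<open>g\<close> to \<open>z \<in> \<Bbbk>G\<close>.
\<close>
definition hash :: "('g \<Rightarrow> 'k::field) \<Rightarrow> ('g \<Rightarrow> 'k) \<Rightarrow> ('g \<times> 'g \<Rightarrow> 'k)"  (infix \<open>\<sharp>\<close> 70)
  where "f \<sharp> z = (\<lambda>(s, h). z s * f h)"

definition id_eps :: "('g::finite \<times> 'g \<Rightarrow> 'k::field) \<Rightarrow> ('g \<Rightarrow> 'k)"
  where "id_eps a = (\<lambda>s. \<Sum>h\<in>UNIV. a (s, h))"

definition ev1_id :: "('g::group_add \<times> 'g \<Rightarrow> 'k::field) \<Rightarrow> ('g \<Rightarrow> 'k)"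
  where "ev1_id a = (\<lambda>h. a (0, h))"

definition components ::
  "(('g::{finite,group_add} \<times> 'g) \<times> ('g \<times> 'g) \<Rightarrow> 'k::field) \<Rightarrow>
    (('g \<Rightarrow> 'k) \<Rightarrow> ('g \<Rightarrow> 'k)) \<times> (('g \<Rightarrow> 'k) \<Rightarrow> ('g \<Rightarrow> 'k)) \<times>
    (('g \<Rightarrow> 'k) \<Rightarrow> ('g \<Rightarrow> 'k)) \<times> (('g \<Rightarrow> 'k) \<Rightarrow> ('g \<Rightarrow> 'k))"
  where "components R =
    ((\<lambda>f. id_eps (F_map R (f \<sharp> bas 0))),
     (\<lambda>z. id_eps (F_map R (1 \<sharp> z))),
     (\<lambda>f. ev1_id (F_map R (f \<sharp> bas 0))),
     (\<lambda>z. ev1_id (F_map R (1 \<sharp> z))))"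


section \<open>Matrices of automorphisms\<close>

definition character :: "('g::group_add \<Rightarrow> 'k::field) \<Rightarrow> bool"
  where "character \<chi> \<longleftrightarrow> (\<forall>x. \<chi> x \<noteq> 0) \<and> (\<forall>x y. \<chi> (x + y) = \<chi> x * \<chi> y)"

definition central_subgroup :: "'g::group_add set \<Rightarrow> bool"
  where "central_subgroup A \<longleftrightarrow> 0 \<in> A \<and> (\<forall>a\<in>A. \<forall>b\<in>A. a + b \<in> A) \<and> (\<forall>a\<in>A. - a \<in> A) \<and>
    (\<forall>a\<in>A. \<forall>x. a + x = x + a)"

definition supported_on :: "'g set \<Rightarrow> ('g \<Rightarrow> 'k::field) set"
  where "supported_on A = {f. \<forall>x. x \<notin> A \<longrightarrow> f x = 0}"

text \<open>
  \<open>\<Bbbk>\<^sup>A\<close> and \<open>\<Bbbk>B\<close>, for subgroups \<open>A\<close> and \<open>B\<close>, are the functions supported on \<open>A\<close> and on \<open>B\<close>. The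
  first conjunct after \<open>central_subgroup B\<close> says that \<open>\<gamma>\<close> factors through restriction to \<open>A\<close>,
  the second that the factor is a bijection from \<open>\<Bbbk>\<^sup>A\<close> onto \<open>\<Bbbk>B\<close>. This bijection is an isomorphism of
  Hopf algebras because \<open>\<gamma>\<close>, the (surjective) restriction and the (injective) inclusion are Hopf
  algebra maps. The maps \<open>\<gamma>\<close> of this form are the same for \<open>\<Bbbk>\<^sup>G\<close> and \<open>\<Bbbk>\<^sup>G\<^sup> \<^sup>c\<^sup>o\<close>, since \<open>\<Bbbk>G\<close> is
  cocommutative.
\<close>
definition central_factor_map :: "(('g::{finite,group_add} \<Rightarrow> 'k::field) \<Rightarrow> ('g \<Rightarrow> 'k)) \<Rightarrow> bool"
  where "central_factor_map \<gamma> \<longleftrightarrow> hopf_hom fun_co grp_alg \<gamma> \<and>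
    (\<exists>A B. central_subgroup A \<and> central_subgroup B \<and>
      (\<forall>f. \<gamma> f = \<gamma> (\<lambda>x. if x \<in> A then f x else 0)) \<and>
      bij_betw \<gamma> (supported_on A) (supported_on B))"

text \<open>
  The last conjunct is \<open>X(f \<bowtie> x) = \<beta>(x) \<alpha>(f\<^sub>1) \<bowtie> \<gamma>(f\<^sub>2) \<delta>(x)\<close> with the coproduct of \<open>\<Bbbk>\<^sup>G\<^sup> \<^sup>c\<^sup>o\<close>.
  Hopf algebra endomorphisms of \<open>\<Bbbk>\<^sup>G\<close> and of \<open>\<Bbbk>\<^sup>G\<^sup> \<^sup>c\<^sup>o\<close> are the same maps.
\<close>
definition has_matrix ::
  "(('g::{finite,group_add} \<times> 'g \<Rightarrow> 'k::field) \<Rightarrow> ('g \<times> 'g \<Rightarrow> 'k)) \<Rightarrow>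
    (('g \<Rightarrow> 'k) \<Rightarrow> ('g \<Rightarrow> 'k)) \<Rightarrow> (('g \<Rightarrow> 'k) \<Rightarrow> ('g \<Rightarrow> 'k)) \<Rightarrow>
    (('g \<Rightarrow> 'k) \<Rightarrow> ('g \<Rightarrow> 'k)) \<Rightarrow> (('g \<Rightarrow> 'k) \<Rightarrow> ('g \<Rightarrow> 'k)) \<Rightarrow> bool"
  where "has_matrix X \<alpha> \<beta> \<gamma> \<delta> \<longleftrightarrow>
    hopf_hom fun_co fun_co \<alpha> \<and>
    (\<exists>b. (\<forall>x. character (b x)) \<and> (\<forall>x y. b (x + y) = b x * b y) \<and> \<beta> = lin_ext b) \<and>
    central_factor_map \<gamma> \<and>
    (\<exists>d. (\<forall>x y. d (x + y) = d x + d y) \<and> \<delta> = lin_ext (\<lambda>x. bas (d x))) \<and>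
    (\<forall>f x. X (f \<otimes> bas x) =
      lin_ext (\<lambda>(s, t). (\<beta> (bas x) * \<alpha> (bas s)) \<otimes> hmul grp_alg (\<gamma> (bas t)) (\<delta> (bas x)))
        (hcomul fun_co f))"

end

theory Submission
  imports Defs
begin

text \<open>
  The equivalence of (1) and (2) is linear algebra: \<open>F\<close> is injective, and
  \<open>F((X \<otimes> X)(R)) = X \<circ> F(R) \<circ> X\<^sup>*\<close> for every linear \<open>X\<close>. What remains is to recognise when
  \<open>R'\<close> equals \<open>(X \<otimes> X)(R)\<close> by looking at components, and two facts achieve this.

  First, a quasitriangular structure of the double is determined by its components
  (\<open>components_determine\<close>). The reason is the shape found in \<open>quasitriangular_double_component_form\<close>: the coefficient of
  \<open>R\<close> at \<open>(e\<^sub>g \<bowtie> y) \<otimes> (e\<^sub>s \<bowtie> z)\<close> is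
    \<open>r(g, s) P(y \<mu>(s)\<^sup>-\<^sup>1, z \<nu>(g)\<^sup>-\<^sup>1)\<close>,
  where \<open>u(f) = f \<circ> \<mu>\<close>, \<open>v(g) = \<nu>(g)\<close>, and \<open>r\<close>, \<open>P\<close> are the matrices of the components \<open>r\<close> and
  \<open>p\<close>. To see this, compare \<open>R \<Delta>(e\<^sub>x) = \<tau>\<Delta>(e\<^sub>x) R\<close> coefficientwise: at \<open>g = 1\<close> it forces \<open>s\<close> and \<open>z\<close> to
  commute whenever the coefficient does not vanish, so the twisted product of the double
  turns into an honest convolution there, and the coproduct axioms yield families of orthogonal
  idempotents of the field, that is, delta functions. These are \<open>\<mu>\<close> and, by the same argument on
  the other leg, \<open>\<nu>\<close>. As \<open>s\<close> is arbitrary, \<open>P\<close> is supported on central elements, and centrality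
  removes the conjugations from the axioms for arbitrary \<open>g\<close> and \<open>s\<close>.

  Second, \<open>(X \<otimes> X)(R)\<close> is again quasitriangular, being the image of \<open>R\<close> under a
  surjective Hopf algebra map (\<open>quasitriangular_hopf_hom\<close>), and its components are the
  right-hand sides of (3) (\<open>transported_components\<close>). The
  matrix of \<open>X\<close> has the same shape as \<open>R\<close>: the coefficient of \<open>X(e\<^sub>x \<bowtie> h)\<close> at \<open>e\<^sub>a \<bowtie> y\<close> is
    \<open>\<beta>(h)(a) \<Gamma>(x \<alpha>\<^sup>*(a)\<^sup>-\<^sup>1, y \<delta>(h)\<^sup>-\<^sup>1)\<close>,
  with \<open>\<Gamma>\<close> the matrix of \<open>\<gamma>\<close>. A change of summation variables then makes the components of
  \<open>(X \<otimes> X)(R)\<close> explicit. Except for \<open>r'\<close>, the fourfold convolutions in (3) contain \<open>\<Gamma>\<close> more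
  often than these sums do; since \<open>\<gamma>\<close> is multiplicative and its matrix is supported on
  central elements, the superfluous factors can be moved next to each other and merged.
\<close>

section \<open>Linear maps in coordinates\<close>

lemma lin_ext_apply: "lin_ext \<phi> f c = (\<Sum>b\<in>UNIV. f b * \<phi> b c)"
  by (simp add: lin_ext_def sum_fun_apply scale_def)

lemma bilin_ext_apply: "bilin_ext \<phi> f g d = (\<Sum>b\<in>UNIV. \<Sum>c\<in>UNIV. f b * g c * \<phi> b c d)"
  by (simp add: bilin_ext_def sum_fun_apply scale_def)

lemma tensor_apply: "(f \<otimes> g) (b, c) = f b * g c"
  by (simp add: tensor_def)

lemma bas_apply: "bas b c = (if c = b then 1 else 0)"
  by (simp add: bas_def)

lemma bas_pair: "bas (b, c) = (bas b \<otimes> bas c :: _ \<Rightarrow> 'k::field)"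
  by (auto simp: bas_def tensor_def fun_eq_iff)

lemma sum_delta_mult:
  fixes f :: "'b::finite \<Rightarrow> 'k::field"
  shows "(\<Sum>b\<in>UNIV. (if b = a then 1 else 0) * f b) = f a"
    and "(\<Sum>b\<in>UNIV. (if a = b then 1 else 0) * f b) = f a"
    and "(\<Sum>b\<in>UNIV. f b * (if b = a then 1 else 0)) = f a"
    and "(\<Sum>b\<in>UNIV. f b * (if a = b then 1 else 0)) = f a"
  by (simp_all add: if_mult_0 cong: if_cong)

lemma lin_ext_bas: "lin_ext \<phi> (bas b) = \<phi> b"
  by (simp add: fun_eq_iff lin_ext_apply bas_apply sum_delta_mult)

lemma bilin_ext_bas: "bilin_ext \<phi> (bas b) (bas c) = \<phi> b c"
  by (simp add: fun_eq_iff bilin_ext_apply bas_apply if_mult_0 sum_if_0 cong: if_cong)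

lemma lin_ext_of_bas: "lin_ext bas f = f"
  by (simp add: fun_eq_iff lin_ext_apply bas_apply sum_delta_mult)

lemma is_linear_iff:
  "is_linear \<phi> \<longleftrightarrow> (\<forall>f. \<phi> f = lin_ext (\<lambda>b. \<phi> (bas b)) f)"
  for \<phi> :: "('b::finite \<Rightarrow> 'k::field) \<Rightarrow> ('c \<Rightarrow> 'k)"
proof
  assume "is_linear \<phi>"
  then interpret Vector_Spaces.linear scale scale \<phi>
    by (simp add: is_linear_def)
  have "\<phi> (\<Sum>b\<in>UNIV. scale (f b) (bas b)) = lin_ext (\<lambda>b. \<phi> (bas b)) f" for f
    by (simp add: sum scale lin_ext_def)
  then show "\<forall>f. \<phi> f = lin_ext (\<lambda>b. \<phi> (bas b)) f"
    by (metis lin_ext_def lin_ext_of_bas)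
next
  assume *: "\<forall>f. \<phi> f = lin_ext (\<lambda>b. \<phi> (bas b)) f"
  have "\<phi> (f + g) = \<phi> f + \<phi> g" for f g
    by (subst (1 2 3) *[rule_format])
      (simp add: fun_eq_iff lin_ext_apply distrib_right sum.distrib)
  moreover have "\<phi> (scale c f) = scale c (\<phi> f)" for c f
    by (subst (1 2) *[rule_format])
      (simp add: fun_eq_iff lin_ext_apply scale_def sum_distrib_left mult.assoc)
  ultimately show "is_linear \<phi>"
    unfolding is_linear_def
    by unfold_locales (auto simp: scale_def fun_eq_iff algebra_simps)
qed

lemma linear_apply:
  "is_linear \<phi> \<Longrightarrow> \<phi> f c = (\<Sum>b\<in>UNIV. f b * \<phi> (bas b) c)"
  for \<phi> :: "('b::finite \<Rightarrow> 'k::field) \<Rightarrow> ('c \<Rightarrow> 'k)"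
  by (metis is_linear_iff lin_ext_apply)

lemma is_linear_lin_ext: "is_linear (lin_ext \<phi>)"
  by (simp add: is_linear_iff lin_ext_bas)

lemma is_linearI:
  assumes "\<And>f c. \<phi> f c = (\<Sum>b\<in>UNIV. f b * \<phi>' b c)"
  shows "is_linear (\<phi> :: ('b::finite \<Rightarrow> 'k::field) \<Rightarrow> ('c \<Rightarrow> 'k))"
proof -
  have "\<phi> = lin_ext \<phi>'"
    by (simp add: fun_eq_iff lin_ext_apply assms)
  then show ?thesis by (simp add: is_linear_lin_ext)
qed

lemma is_linear_comp: "is_linear \<phi> \<Longrightarrow> is_linear \<psi> \<Longrightarrow> is_linear (\<lambda>f. \<phi> (\<psi> f))"
  for \<psi> :: "('a::finite \<Rightarrow> 'k::field) \<Rightarrow> ('b::finite \<Rightarrow> 'k)"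
    and \<phi> :: "('b \<Rightarrow> 'k) \<Rightarrow> ('c \<Rightarrow> 'k)"
proof (rule is_linearI)
  fix f c
  assume \<phi>: "is_linear \<phi>" and \<psi>: "is_linear \<psi>"
  have "\<phi> (\<psi> f) c = (\<Sum>b\<in>UNIV. (\<Sum>a\<in>UNIV. f a * \<psi> (bas a) b) * \<phi> (bas b) c)"
    by (simp add: linear_apply[OF \<phi>, of "\<psi> f"] linear_apply[OF \<psi>, of f])
  also have "\<dots> = (\<Sum>a\<in>UNIV. \<Sum>b\<in>UNIV. f a * \<psi> (bas a) b * \<phi> (bas b) c)"
    by (subst sum.swap) (simp add: sum_distrib_right)
  also have "\<dots> = (\<Sum>a\<in>UNIV. f a * (\<Sum>b\<in>UNIV. \<psi> (bas a) b * \<phi> (bas b) c))"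
    by (simp add: sum_distrib_left mult.assoc)
  finally show "\<phi> (\<psi> f) c = (\<Sum>a\<in>UNIV. f a * (\<Sum>b\<in>UNIV. \<psi> (bas a) b * \<phi> (bas b) c))" .
qed

lemma linear_eqI:
  fixes \<phi> \<psi> :: "('b::finite \<Rightarrow> 'k::field) \<Rightarrow> ('c \<Rightarrow> 'k)"
  assumes "is_linear \<phi>" "is_linear \<psi>" "\<And>b. \<phi> (bas b) = \<psi> (bas b)"
  shows "\<phi> f = \<psi> f"
  by (rule ext)
    (simp add: linear_apply[OF assms(1), of f] linear_apply[OF assms(2), of f] assms(3))

lemma is_linear_id: "is_linear (id :: ('b::finite \<Rightarrow> 'k::field) \<Rightarrow> _)"
  by (simp add: is_linear_iff lin_ext_of_bas)

section \<open>Tensor products of maps\<close>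

lemma tensor_map_apply:
  "tensor_map \<phi> \<psi> T (c, e) = (\<Sum>b\<in>UNIV. \<Sum>d\<in>UNIV. T (b, d) * (\<phi> (bas b) c * \<psi> (bas d) e))"
  by (simp add: tensor_map_def lin_ext_apply sum_UNIV_prod tensor_apply)

lemma is_linear_tensor_map: "is_linear (tensor_map \<phi> \<psi>)"
  unfolding tensor_map_def by (rule is_linear_lin_ext)

lemma tensor_map_tensor:
  assumes "is_linear \<phi>" "is_linear \<psi>"
  shows "tensor_map \<phi> \<psi> (f \<otimes> g) = \<phi> f \<otimes> \<psi> g"
proof (rule ext, clarify)
  fix c e
  show "tensor_map \<phi> \<psi> (f \<otimes> g) (c, e) = (\<phi> f \<otimes> \<psi> g) (c, e)"
    by (simp add: tensor_map_apply tensor_apply linear_apply[OF assms(1), of f]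
        linear_apply[OF assms(2), of g] sum_product mult.assoc mult.left_commute)
qed

lemma tensor_map_bas: "tensor_map \<phi> \<psi> (bas (b, d)) = \<phi> (bas b) \<otimes> \<psi> (bas d)"
  by (simp add: tensor_map_def lin_ext_bas)

lemma tensor_map_comp:
  assumes "is_linear \<phi>" "is_linear \<psi>"
  shows "tensor_map \<phi> \<psi> (tensor_map \<phi>' \<psi>' (T :: 'e::finite \<times> 'f::finite \<Rightarrow> 'k::field)) =
    tensor_map (\<lambda>f. \<phi> (\<phi>' f)) (\<lambda>f. \<psi> (\<psi>' f)) T"
proof (rule linear_eqI[where f = T])
  show "is_linear (\<lambda>T. tensor_map \<phi> \<psi> (tensor_map \<phi>' \<psi>' T))"
    by (rule is_linear_comp[OF is_linear_tensor_map is_linear_tensor_map])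
  fix b :: "'e \<times> 'f"
  show "tensor_map \<phi> \<psi> (tensor_map \<phi>' \<psi>' (bas b)) =
    tensor_map (\<lambda>f. \<phi> (\<phi>' f)) (\<lambda>f. \<psi> (\<psi>' f)) (bas b)"
    by (cases b) (simp add: tensor_map_bas tensor_map_tensor assms)
qed (rule is_linear_tensor_map)

lemma is_linear_assoc_tensor: "is_linear (assoc_tensor ::
    (('b::finite \<times> 'c::finite) \<times> 'd::finite \<Rightarrow> 'k::field) \<Rightarrow> _)"
proof (rule is_linearI)
  fix f :: "('b \<times> 'c) \<times> 'd \<Rightarrow> 'k" and c :: "'b \<times> 'c \<times> 'd"
  obtain x y z where "c = (x, y, z)" by (cases c)
  moreover have "assoc_tensor f (x, y, z) = f ((x, y), z)" for f :: "('b \<times> 'c) \<times> 'd \<Rightarrow> 'k"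
    by (simp add: assoc_tensor_def)
  ultimately show "assoc_tensor f c = (\<Sum>b\<in>UNIV. f b * assoc_tensor (bas b) c)"
    by (simp only: bas_apply sum_delta_mult)
qed

lemma assoc_tensor_tensor: "assoc_tensor ((f \<otimes> g) \<otimes> h) = f \<otimes> g \<otimes> h"
  by (auto simp: assoc_tensor_def tensor_def fun_eq_iff)

lemma assoc_tensor_map:
  fixes \<phi> :: "('a::finite \<Rightarrow> 'k::field) \<Rightarrow> ('b::finite \<Rightarrow> 'k)"
    and \<psi> :: "('c::finite \<Rightarrow> 'k) \<Rightarrow> ('d::finite \<Rightarrow> 'k)"
    and \<chi> :: "('e::finite \<Rightarrow> 'k) \<Rightarrow> ('f::finite \<Rightarrow> 'k)"
  assumes "is_linear \<phi>" "is_linear \<psi>" "is_linear \<chi>"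
  shows "assoc_tensor (tensor_map (tensor_map \<phi> \<psi>) \<chi> T) =
    tensor_map \<phi> (tensor_map \<psi> \<chi>) (assoc_tensor T)"
proof (rule linear_eqI[where f = T])
  show "is_linear (\<lambda>T. assoc_tensor (tensor_map (tensor_map \<phi> \<psi>) \<chi> T))"
    by (rule is_linear_comp[OF is_linear_assoc_tensor is_linear_tensor_map])
  show "is_linear (\<lambda>T. tensor_map \<phi> (tensor_map \<psi> \<chi>) (assoc_tensor T))"
    by (rule is_linear_comp[OF is_linear_tensor_map is_linear_assoc_tensor])
  fix b :: "('a \<times> 'c) \<times> 'e"
  show "assoc_tensor (tensor_map (tensor_map \<phi> \<psi>) \<chi> (bas b)) =
    tensor_map \<phi> (tensor_map \<psi> \<chi>) (assoc_tensor (bas b))"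
    by (cases b; cases "fst b")
      (simp add: bas_pair tensor_map_tensor assoc_tensor_tensor is_linear_tensor_map assms)
qed

lemma tensor_mul_apply:
  "tensor_mul m n A B (i, j) = (\<Sum>b\<in>UNIV. \<Sum>c\<in>UNIV. \<Sum>b'\<in>UNIV. \<Sum>c'\<in>UNIV.
    A (b, c) * B (b', c') * (m (bas b) (bas b') i * n (bas c) (bas c') j))"
  by (simp add: tensor_mul_def bilin_ext_apply sum_UNIV_prod tensor_apply)

text \<open>
  Stated as linearity in each argument, so that closure under composition with linear
  maps is inherited from \<open>is_linear_comp\<close>.
\<close>
definition is_bilinear :: "(('b::finite \<Rightarrow> 'k::field) \<Rightarrow> ('c::finite \<Rightarrow> 'k) \<Rightarrow> ('d \<Rightarrow> 'k)) \<Rightarrow> bool"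
  where "is_bilinear m \<longleftrightarrow> (\<forall>f. is_linear (m f)) \<and> (\<forall>g. is_linear (\<lambda>f. m f g))"

lemma bilinear_apply:
  assumes "is_bilinear m"
  shows "m f g d = (\<Sum>b\<in>UNIV. \<Sum>c\<in>UNIV. f b * g c * m (bas b) (bas c) d)"
proof -
  have "m f g d = (\<Sum>b\<in>UNIV. f b * m (bas b) g d)"
    using assms linear_apply[of "\<lambda>f. m f g" f d] by (simp add: is_bilinear_def)
  moreover have "m (bas b) g d = (\<Sum>c\<in>UNIV. g c * m (bas b) (bas c) d)" for b
    using assms linear_apply[of "m (bas b)" g d] by (simp add: is_bilinear_def)
  ultimately show ?thesis by (simp add: sum_distrib_left mult.assoc)
qed

lemma is_bilinear_bilin_ext: "is_bilinear (bilin_ext \<phi>)"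
  unfolding is_bilinear_def
proof safe
  show "is_linear (bilin_ext \<phi> f)" for f
    by (rule is_linearI[where \<phi>' = "\<lambda>c d. \<Sum>b\<in>UNIV. f b * \<phi> b c d"])
      (subst bilin_ext_apply, subst sum.swap, simp add: sum_distrib_left ac_simps)
  show "is_linear (\<lambda>f. bilin_ext \<phi> f g)" for g
    by (rule is_linearI[where \<phi>' = "\<lambda>b d. \<Sum>c\<in>UNIV. g c * \<phi> b c d"])
      (subst bilin_ext_apply, simp add: sum_distrib_left ac_simps)
qed

lemma is_bilinear_tensor_mul: "is_bilinear (tensor_mul m n)"
  unfolding tensor_mul_def by (rule is_bilinear_bilin_ext)

lemma bilinear_eqI:
  assumes "is_bilinear \<Phi>" "is_bilinear \<Psi>" "\<And>i j. \<Phi> (bas i) (bas j) = \<Psi> (bas i) (bas j)"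
  shows "\<Phi> a b = \<Psi> a b"
  by (rule ext) (simp add: bilinear_apply[OF assms(1), of a b] bilinear_apply[OF assms(2), of a b]
      assms(3))

lemma tensor_mul_tensor:
  assumes "is_bilinear m" "is_bilinear n"
  shows "tensor_mul m n (f \<otimes> g) (f' \<otimes> g') = m f f' \<otimes> n g g'"
proof (rule ext, clarify)
  fix i j
  show "tensor_mul m n (f \<otimes> g) (f' \<otimes> g') (i, j) = (m f f' \<otimes> n g g') (i, j)"
    by (simp add: tensor_mul_apply tensor_apply bilinear_apply[OF assms(1), of f f']
        bilinear_apply[OF assms(2), of g g'] sum_product mult_ac)
qed

text \<open>
  Both sides are bilinear, so it suffices to compare them on tensors of basis elements.
  Taking \<open>\<psi>\<close> to be itself a tensor product of multiplicative maps extends this to three factors.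
\<close>
lemma tensor_map_tensor_mul:
  assumes m: "is_bilinear m" "is_bilinear m'" and n: "is_bilinear n" "is_bilinear n'"
    and \<phi>: "is_linear \<phi>" "\<And>a b. \<phi> (m a b) = m' (\<phi> a) (\<phi> b)"
    and \<psi>: "is_linear \<psi>" "\<And>a b. \<psi> (n a b) = n' (\<psi> a) (\<psi> b)"
  shows "tensor_map \<phi> \<psi> (tensor_mul m n A B) =
    tensor_mul m' n' (tensor_map \<phi> \<psi> A) (tensor_map \<phi> \<psi> B)"
proof (rule bilinear_eqI[where a = A and b = B])
  have lin: "is_linear (tensor_mul m n A)" "is_linear (\<lambda>A. tensor_mul m n A A')"
    "is_linear (tensor_mul m' n' B)" "is_linear (\<lambda>A. tensor_mul m' n' A B')" for A A' B B'
    using is_bilinear_tensor_mul[of m n] is_bilinear_tensor_mul[of m' n']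
    by (auto simp: is_bilinear_def)
  show "is_bilinear (\<lambda>A B. tensor_map \<phi> \<psi> (tensor_mul m n A B))"
    unfolding is_bilinear_def
    using is_linear_comp[OF is_linear_tensor_map lin(1)]
      is_linear_comp[OF is_linear_tensor_map lin(2)] by blast
  show "is_bilinear (\<lambda>A B. tensor_mul m' n' (tensor_map \<phi> \<psi> A) (tensor_map \<phi> \<psi> B))"
    unfolding is_bilinear_def
    using is_linear_comp[OF lin(3) is_linear_tensor_map]
      is_linear_comp[OF lin(4) is_linear_tensor_map] by blast
  fix i :: "'a \<times> 'd" and j
  show "tensor_map \<phi> \<psi> (tensor_mul m n (bas i) (bas j)) =
    tensor_mul m' n' (tensor_map \<phi> \<psi> (bas i)) (tensor_map \<phi> \<psi> (bas j))"
    by (cases i; cases j) (simp add: bas_pair tensor_mul_tensor tensor_map_tensor m n \<phi> \<psi>)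
qed

section \<open>Quasitriangular structures under Hopf maps\<close>

lemma hopf_homD:
  assumes "hopf_hom H K \<phi>"
  shows "is_linear \<phi>" "\<phi> (hmul H a b) = hmul K (\<phi> a) (\<phi> b)" "\<phi> (hunit H) = hunit K"
    "hcomul K (\<phi> a) = tensor_map \<phi> \<phi> (hcomul H a)" "hcounit K (\<phi> a) = hcounit H a"
  using assms by (simp_all add: hopf_hom_def)

lemma hopf_hom_unit_apply:
  "hopf_hom H K \<phi> \<Longrightarrow> hunit K j = (\<Sum>b\<in>UNIV. hunit H b * \<phi> (bas b) j)"
  by (metis hopf_homD(1,3) linear_apply)

lemma tensor_map3_apply:
  "tensor_map \<phi> (tensor_map \<psi> \<chi>) T (i, j, k) = (\<Sum>a\<in>UNIV. \<Sum>b\<in>UNIV. \<Sum>c\<in>UNIV.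
    T (a, b, c) * (\<phi> (bas a) i * (\<psi> (bas b) j * \<chi> (bas c) k)))"
  by (subst tensor_map_apply) (simp only: sum_UNIV_prod tensor_map_bas tensor_apply)

text \<open>
  The leg of \<open>R\<close> that holds the unit stays the unit because \<open>\<phi>\<close> preserves units.
\<close>
lemma tensor_map_legs:
  assumes "hopf_hom H K \<phi>"
  shows "tensor_map \<phi> (tensor_map \<phi> \<phi>) (leg12 H R) = leg12 K (tensor_map \<phi> \<phi> R)"
    and "tensor_map \<phi> (tensor_map \<phi> \<phi>) (leg13 H R) = leg13 K (tensor_map \<phi> \<phi> R)"
    and "tensor_map \<phi> (tensor_map \<phi> \<phi>) (leg23 H R) = leg23 K (tensor_map \<phi> \<phi> R)"
proof -
  note simps = tensor_map_apply leg12_def leg13_def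
    leg23_def hopf_hom_unit_apply[OF assms] sum_distrib_left sum_distrib_right
  show "tensor_map \<phi> (tensor_map \<phi> \<phi>) (leg12 H R) = leg12 K (tensor_map \<phi> \<phi> R)"
    unfolding fun_eq_iff split_paired_All tensor_map3_apply by (simp add: simps mult_ac)
  show "tensor_map \<phi> (tensor_map \<phi> \<phi>) (leg13 H R) = leg13 K (tensor_map \<phi> \<phi> R)"
  proof (rule ext, clarify)
    fix i j k
    have "tensor_map \<phi> (tensor_map \<phi> \<phi>) (leg13 H R) (i, j, k) = (\<Sum>a\<in>UNIV. \<Sum>b\<in>UNIV. \<Sum>c\<in>UNIV.
        R (a, c) * hunit H b * (\<phi> (bas a) i * (\<phi> (bas b) j * \<phi> (bas c) k)))"
      unfolding tensor_map3_apply by (simp add: simps)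
    also have "\<dots> = (\<Sum>a\<in>UNIV. \<Sum>c\<in>UNIV. \<Sum>b\<in>UNIV.
        R (a, c) * hunit H b * (\<phi> (bas a) i * (\<phi> (bas b) j * \<phi> (bas c) k)))"
      by (rule sum.cong[OF refl sum.swap])
    also have "\<dots> = leg13 K (tensor_map \<phi> \<phi> R) (i, j, k)"
      by (simp add: simps mult_ac)
    finally show "tensor_map \<phi> (tensor_map \<phi> \<phi>) (leg13 H R) (i, j, k) =
      leg13 K (tensor_map \<phi> \<phi> R) (i, j, k)" .
  qed
  show "tensor_map \<phi> (tensor_map \<phi> \<phi>) (leg23 H R) = leg23 K (tensor_map \<phi> \<phi> R)"
  proof (rule ext, clarify)
    fix i j k
    have "tensor_map \<phi> (tensor_map \<phi> \<phi>) (leg23 H R) (i, j, k) = (\<Sum>a\<in>UNIV. \<Sum>b\<in>UNIV. \<Sum>c\<in>UNIV.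
        R (b, c) * hunit H a * (\<phi> (bas a) i * (\<phi> (bas b) j * \<phi> (bas c) k)))"
      unfolding tensor_map3_apply by (simp add: simps)
    also have "\<dots> = hunit K i * tensor_map \<phi> \<phi> R (j, k)"
      unfolding hopf_hom_unit_apply[OF assms, of i] tensor_map_apply
      by (subst sum_distrib_right) (simp add: sum_distrib_left mult_ac)
    finally show "tensor_map \<phi> (tensor_map \<phi> \<phi>) (leg23 H R) (i, j, k) =
      leg23 K (tensor_map \<phi> \<phi> R) (i, j, k)"
      by (simp add: leg23_def mult.commute)
  qed
qed

lemma tensor_map_flip: "tensor_map \<psi> \<phi> (flip T) = flip (tensor_map \<phi> \<psi> T)"
  unfolding fun_eq_iff split_paired_All
  by (subst (2) flip_def, simp add: tensor_map_apply, subst sum.swap) (simp add: flip_def mult_ac)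

text \<open>
  Each axiom of \<open>R\<close> is an identity between expressions in the structure maps, and \<open>\<phi>\<close> on
  every tensor factor carries it to the same identity for the image of \<open>R\<close>. Surjectivity is
  what makes the commutation axiom hold against every element of the target.
\<close>
lemma quasitriangular_hopf_hom:
  assumes H: "is_bilinear (hmul H)"
    and K: "is_bilinear (hmul K)" "is_linear (hcomul K)"
    and cK: "\<And>a. hcounit K a = (\<Sum>i\<in>UNIV. a i * hcounit K (bas i))"
    and \<phi>: "hopf_hom H K \<phi>" "surj \<phi>"
    and R: "quasitriangular H R"
  shows "quasitriangular K (tensor_map \<phi> \<phi> R)"
proof -
  let ?T2 = "tensor_map \<phi> \<phi>" and ?T3 = "tensor_map \<phi> (tensor_map \<phi> \<phi>)"
  let ?m2 = "tensor_mul (hmul H) (hmul H)" and ?n2 = "tensor_mul (hmul K) (hmul K)"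
  let ?m3 = "tensor_mul (hmul H) ?m2" and ?n3 = "tensor_mul (hmul K) ?n2"
  note hom = hopf_homD[OF \<phi>(1)]
  have mul2: "?T2 (?m2 A B) = ?n2 (?T2 A) (?T2 B)" for A B
    by (rule tensor_map_tensor_mul) (simp_all add: H K hom)
  have mul3: "?T3 (?m3 A B) = ?n3 (?T3 A) (?T3 B)" for A B
    by (rule tensor_map_tensor_mul)
      (simp_all add: H K hom is_bilinear_tensor_mul is_linear_tensor_map mul2)
  note R = R[unfolded quasitriangular_def Let_def]
  have "assoc_tensor (tensor_map (hcomul K) id (?T2 R)) =
      assoc_tensor (tensor_map ?T2 \<phi> (tensor_map (hcomul H) id R))"
    by (simp add: tensor_map_comp is_linear_tensor_map is_linear_id K hom)
  also have "\<dots> = ?T3 (assoc_tensor (tensor_map (hcomul H) id R))"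
    by (rule assoc_tensor_map) (simp_all add: hom)
  also have "\<dots> = ?n3 (leg13 K (?T2 R)) (leg23 K (?T2 R))"
    by (simp add: R mul3 tensor_map_legs[OF \<phi>(1)])
  finally have 1: "assoc_tensor (tensor_map (hcomul K) id (?T2 R)) =
    ?n3 (leg13 K (?T2 R)) (leg23 K (?T2 R))" .
  have "tensor_map id (hcomul K) (?T2 R) = ?T3 (tensor_map id (hcomul H) R)"
    by (simp add: tensor_map_comp is_linear_tensor_map is_linear_id K hom)
  also have "\<dots> = ?n3 (leg13 K (?T2 R)) (leg12 K (?T2 R))"
    by (simp add: R mul3 tensor_map_legs[OF \<phi>(1)])
  finally have 2: "tensor_map id (hcomul K) (?T2 R) =
    ?n3 (leg13 K (?T2 R)) (leg12 K (?T2 R))" .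
  have counit: "(\<Sum>i\<in>UNIV. hcounit K (bas i) * \<phi> a i) = hcounit H a" for a
    by (metis (mono_tags, lifting) cK hom(5) mult.commute sum.cong)
  have 3: "(\<Sum>i\<in>UNIV. hcounit K (bas i) * ?T2 R (i, j)) = hunit K j" for j
  proof -
    have "(\<Sum>i\<in>UNIV. hcounit K (bas i) * ?T2 R (i, j)) =
        (\<Sum>i\<in>UNIV. \<Sum>a\<in>UNIV. \<Sum>b\<in>UNIV. hcounit K (bas i) * \<phi> (bas a) i * (R (a, b) * \<phi> (bas b) j))"
      by (simp add: tensor_map_apply sum_distrib_left mult_ac)
    also have "\<dots> = (\<Sum>a\<in>UNIV. \<Sum>i\<in>UNIV. \<Sum>b\<in>UNIV.
        hcounit K (bas i) * \<phi> (bas a) i * (R (a, b) * \<phi> (bas b) j))"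
      by (rule sum.swap)
    also have "\<dots> = (\<Sum>a\<in>UNIV. \<Sum>b\<in>UNIV. hcounit H (bas a) * (R (a, b) * \<phi> (bas b) j))"
      by (simp only: sum_distrib_left[symmetric] sum_distrib_right[symmetric] counit)
    also have "\<dots> = (\<Sum>b\<in>UNIV. (\<Sum>a\<in>UNIV. hcounit H (bas a) * R (a, b)) * \<phi> (bas b) j)"
      by (subst sum.swap) (simp add: sum_distrib_right mult.assoc)
    also have "\<dots> = hunit K j"
      using R by (simp add: hopf_hom_unit_apply[OF \<phi>(1)] fun_eq_iff)
    finally show ?thesis .
  qed
  have 4: "(\<Sum>j\<in>UNIV. ?T2 R (i, j) * hcounit K (bas j)) = hunit K i" for i
  proof -
    have "(\<Sum>j\<in>UNIV. ?T2 R (i, j) * hcounit K (bas j)) =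
        (\<Sum>j\<in>UNIV. \<Sum>a\<in>UNIV. \<Sum>b\<in>UNIV. R (a, b) * \<phi> (bas a) i * (hcounit K (bas j) * \<phi> (bas b) j))"
      by (simp add: tensor_map_apply sum_distrib_left sum_distrib_right mult_ac)
    also have "\<dots> = (\<Sum>a\<in>UNIV. \<Sum>b\<in>UNIV. \<Sum>j\<in>UNIV.
        R (a, b) * \<phi> (bas a) i * (hcounit K (bas j) * \<phi> (bas b) j))"
      by (subst sum.swap) (rule sum.cong[OF refl sum.swap])
    also have "\<dots> = (\<Sum>a\<in>UNIV. \<Sum>b\<in>UNIV. R (a, b) * \<phi> (bas a) i * hcounit H (bas b))"
      by (simp only: sum_distrib_left[symmetric] counit)
    also have "\<dots> = (\<Sum>a\<in>UNIV. (\<Sum>b\<in>UNIV. R (a, b) * hcounit H (bas b)) * \<phi> (bas a) i)"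
      by (simp add: sum_distrib_left mult_ac)
    also have "\<dots> = hunit K i"
      using R by (simp add: hopf_hom_unit_apply[OF \<phi>(1)] fun_eq_iff)
    finally show ?thesis .
  qed
  have 5: "?n2 (?T2 R) (hcomul K h) = ?n2 (flip (hcomul K h)) (?T2 R)" for h
  proof -
    obtain a where "h = \<phi> a" using \<phi>(2) by blast
    then show ?thesis
      using R by (simp add: hom tensor_map_flip[symmetric] mul2[symmetric])
  qed
  show ?thesis
    using 1 2 3 4 5 by (simp add: quasitriangular_def Let_def fun_eq_iff)
qed

section \<open>The maps \<open>F(R)\<close>\<close>

lemma F_map_tensor_map:
  fixes X :: "('b::finite \<Rightarrow> 'k::field) \<Rightarrow> ('b \<Rightarrow> 'k)"
  assumes "is_linear X"
  shows "F_map (tensor_map X X R) = X \<circ> (F_map R \<circ> lin_transpose X)"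
proof (rule ext, rule ext)
  fix \<xi> :: "'b \<Rightarrow> 'k" and j
  have "F_map (tensor_map X X R) \<xi> j =
      (\<Sum>i\<in>UNIV. \<Sum>a\<in>UNIV. \<Sum>b\<in>UNIV. \<xi> i * X (bas a) i * R (a, b) * X (bas b) j)"
    by (simp add: F_map_def tensor_map_apply sum_distrib_left mult_ac)
  also have "\<dots> = (\<Sum>a\<in>UNIV. \<Sum>b\<in>UNIV. \<Sum>i\<in>UNIV. \<xi> i * X (bas a) i * R (a, b) * X (bas b) j)"
    by (subst sum.swap) (rule sum.cong[OF refl sum.swap])
  also have "\<dots> = (\<Sum>b\<in>UNIV. \<Sum>a\<in>UNIV. lin_transpose X \<xi> a * R (a, b) * X (bas b) j)"
    by (subst sum.swap) (simp add: lin_transpose_def sum_distrib_right)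
  also have "\<dots> = (X \<circ> (F_map R \<circ> lin_transpose X)) \<xi> j"
    by (simp add: linear_apply[OF assms, of "F_map R (lin_transpose X \<xi>)"])
      (simp add: F_map_def sum_distrib_right)
  finally show "F_map (tensor_map X X R) \<xi> j = (X \<circ> (F_map R \<circ> lin_transpose X)) \<xi> j" .
qed

lemma F_map_bas: "F_map R (bas i) j = R (i, j)"
  by (simp add: F_map_def bas_apply sum_delta_mult)

lemma F_map_inject: "F_map R = F_map S \<longleftrightarrow> R = S"
proof
  assume "F_map R = F_map S"
  then have "R (i, j) = S (i, j)" for i j
    by (metis F_map_bas)
  then show "R = S" by auto
qed simp

section \<open>The double in coordinates\<close>

lemma sum_translate:
  fixes f :: "'g::{finite,group_add} \<Rightarrow> 'k::comm_monoid_add"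
  shows "(\<Sum>x\<in>UNIV. f (c + x)) = (\<Sum>x\<in>UNIV. f x)" "(\<Sum>x\<in>UNIV. f (x - c)) = (\<Sum>x\<in>UNIV. f x)"
proof -
  show "(\<Sum>x\<in>UNIV. f (c + x)) = (\<Sum>x\<in>UNIV. f x)"
    by (rule sum.reindex_bij_witness[of _ "\<lambda>x. - c + x" "\<lambda>x. c + x"])
      (simp_all add: add.assoc[symmetric])
  show "(\<Sum>x\<in>UNIV. f (x - c)) = (\<Sum>x\<in>UNIV. f x)"
    by (rule sum.reindex_bij_witness[of _ "\<lambda>x. x + c" "\<lambda>x. x - c"]) simp_all
qed

lemma double_mul_bas: "hmul double (bas (s, g)) (bas (t, h)) (i, k) =
  (if s = i then 1 else 0) * (if t = - g + i + g then 1 else 0) * (if h = - g + k then 1 else 0 :: 'k::field)"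
proof -
  have "k = g + h \<longleftrightarrow> h = - g + k"
    by (metis add.assoc add.left_neutral left_minus right_minus)
  then show ?thesis
    by (auto simp: double_def bilin_ext_bas tensor_apply conj_act_def bas_apply)
qed

lemma is_bilinear_double: "is_bilinear (hmul double)"
  by (simp add: double_def is_bilinear_bilin_ext)

lemma double_mul_apply: "hmul double a b (s, k) =
  (\<Sum>g\<in>UNIV. a (s, g) * b (- g + s + g, - g + k) :: 'k::field)"
  by (simp add: bilinear_apply[OF is_bilinear_double, of a b] sum_UNIV_prod double_mul_bas
      if_mult_0 sum_if_0 cong: if_cong)

lemma eq_diff_iff: "(t = x - s) = (x = t + s)" for t :: "'g::group_add"
  by (metis add_diff_cancel diff_add_cancel)

lemma double_comul_apply:
  "hcomul double a ((s, h), (t, h')) = (if h = h' then a (t + s, h) else 0 :: 'k::field)"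
proof -
  have "bas (s', g) (s, h) * bas (x - s', g) (t, h') =
      (if s' = s then (if x = t + s then (if g = h then (if h = h' then 1 else 0) else 0) else 0)
       else 0 :: 'k)" for s' x g
    by (auto simp: bas_apply eq_diff_iff)
  then show ?thesis
    by (simp add: double_def lin_ext_apply sum_UNIV_prod sum_fun_apply tensor_apply
        if_mult_0 sum_if_0 cong: if_cong)
qed

lemma is_linear_double_comul: "is_linear (hcomul double)"
  by (simp add: double_def is_linear_lin_ext)

lemma double_counit_bas: "hcounit double (bas (s, g)) = (if s = 0 then 1 else 0 :: 'k::field)"
  by (simp add: double_def bas_apply)

lemma double_counit: "hcounit double a = (\<Sum>i\<in>UNIV. a i * hcounit double (bas i) :: 'k::field)"
  by (simp add: sum_UNIV_prod double_counit_bas if_mult_0 sum_if_0 cong: if_cong)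
    (simp add: double_def)

lemma double_unit_apply: "hunit double (s, g) = (if g = 0 then 1 else 0)"
  by (simp add: double_def tensor_apply bas_apply)

lemma double_unit:
  "hmul double a (hunit double) = a" "hmul double (hunit double) a = (a :: _ \<Rightarrow> 'k::field)"
proof -
  have "(- g + k = 0) = (g = k)" for g k :: 'a
    by (metis add.inverse_unique add_minus_cancel add.right_neutral left_minus)
  then show "hmul double a (hunit double) = a"
    by (auto simp: fun_eq_iff double_mul_apply double_unit_apply if_mult_0 cong: if_cong)
  show "hmul double (hunit double) a = a"
    by (auto simp: fun_eq_iff double_mul_apply double_unit_apply if_mult_0 cong: if_cong)
qed

lemma tensor_mul_double_apply:
  "tensor_mul (hmul double) (hmul double) A B ((g, y), (s, z)) = (\<Sum>k\<in>UNIV. \<Sum>l\<in>UNIV.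
    A ((g, k), (s, l)) * B ((- k + g + k, - k + y), (- l + s + l, - l + z)) :: 'k::field)"
  by (simp add: tensor_mul_apply sum_UNIV_prod double_mul_bas if_mult_0 sum_if_0 cong: if_cong)

lemma sum_rotate:
  "(\<Sum>x\<in>A. \<Sum>y\<in>B. \<Sum>z\<in>C. f x y z) = (\<Sum>y\<in>B. \<Sum>z\<in>C. \<Sum>x\<in>A. f x y z)"
  by (subst sum.swap) (rule sum.cong[OF refl sum.swap])

text \<open>
  In \<open>R\<^sup>1\<^sup>3 S\<^sup>2\<^sup>3\<close> and in \<open>R\<^sup>1\<^sup>3 S\<^sup>1\<^sup>2\<close> only one tensor factor carries a genuine product; in the
  others a unit meets a basis element. Hence a coefficient of the product is a single product
  in \<open>H\<close> of a row, respectively a column, of \<open>R\<close> with one of \<open>S\<close>.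
\<close>
lemma tensor_mul_legs:
  fixes R S :: "'b::finite \<times> 'b \<Rightarrow> 'k::field"
  assumes "is_bilinear (hmul H)"
    and unit: "\<And>a. hmul H a (hunit H) = a" "\<And>a. hmul H (hunit H) a = a"
  shows "tensor_mul (hmul H) (tensor_mul (hmul H) (hmul H)) (leg13 H R) (leg23 H S) (i, j, k) =
      hmul H (\<lambda>c. R (i, c)) (\<lambda>c. S (j, c)) k" (is "?L = _")
    and "tensor_mul (hmul H) (tensor_mul (hmul H) (hmul H)) (leg13 H R) (leg12 H S) (i, j, k) =
      hmul H (\<lambda>a. R (a, k)) (\<lambda>a. S (a, j)) i" (is "?L' = _")
proof -
  let ?m = "\<lambda>a b. hmul H (bas a) (bas b)"
  have r: "(\<Sum>b\<in>UNIV. hunit H b * ?m a b i) = (if a = i then 1 else 0)" for a i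
  proof -
    have "(\<Sum>b\<in>UNIV. hunit H b * ?m a b i) = hmul H (bas a) (hunit H) i"
      using assms(1) linear_apply[of "hmul H (bas a)" "hunit H" i] by (simp add: is_bilinear_def)
    then show ?thesis by (simp add: unit bas_apply eq_commute)
  qed
  have l: "(\<Sum>a\<in>UNIV. hunit H a * ?m a b i) = (if b = i then 1 else 0)" for b i
  proof -
    have "(\<Sum>a\<in>UNIV. hunit H a * ?m a b i) = hmul H (hunit H) (bas b) i"
      using assms(1) linear_apply[of "\<lambda>a. hmul H a (bas b)" "hunit H" i]
      by (simp add: is_bilinear_def)
    then show ?thesis by (simp add: unit bas_apply eq_commute)
  qed
  have mul3: "tensor_mul (hmul H) (tensor_mul (hmul H) (hmul H)) A B (i, j, k) =
      (\<Sum>a\<in>UNIV. \<Sum>b\<in>UNIV. \<Sum>c\<in>UNIV. \<Sum>a'\<in>UNIV. \<Sum>b'\<in>UNIV. \<Sum>c'\<in>UNIV.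
        A (a, b, c) * B (a', b', c') * (?m a a' i * (?m b b' j * ?m c c' k)))" for A B
    by (subst tensor_mul_apply)
      (simp only: sum_UNIV_prod tensor_mul_def[of "hmul H" "hmul H"] bilin_ext_bas prod.case tensor_apply)
  have "?L = (\<Sum>a\<in>UNIV. \<Sum>b\<in>UNIV. \<Sum>c\<in>UNIV. \<Sum>a'\<in>UNIV. \<Sum>b'\<in>UNIV. \<Sum>c'\<in>UNIV.
      R (a, c) * S (b', c') * ?m c c' k * (hunit H b * ?m b b' j) * (hunit H a' * ?m a a' i))"
    by (simp add: mul3 leg13_def leg23_def mult_ac)
  also have "\<dots> = (\<Sum>a\<in>UNIV. \<Sum>b\<in>UNIV. \<Sum>c\<in>UNIV. \<Sum>b'\<in>UNIV. \<Sum>c'\<in>UNIV. \<Sum>a'\<in>UNIV.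
      R (a, c) * S (b', c') * ?m c c' k * (hunit H b * ?m b b' j) * (hunit H a' * ?m a a' i))"
    by (intro sum.cong refl sum_rotate)
  also have "\<dots> = (\<Sum>a\<in>UNIV. \<Sum>b\<in>UNIV. \<Sum>c\<in>UNIV. \<Sum>b'\<in>UNIV. \<Sum>c'\<in>UNIV.
      R (a, c) * S (b', c') * ?m c c' k * (hunit H b * ?m b b' j) * (if a = i then 1 else 0))"
    by (simp only: sum_distrib_left[symmetric] r)
  also have "\<dots> = (\<Sum>b\<in>UNIV. \<Sum>c\<in>UNIV. \<Sum>b'\<in>UNIV. \<Sum>c'\<in>UNIV.
      R (i, c) * S (b', c') * ?m c c' k * (hunit H b * ?m b b' j))"
    by (simp add: if_mult_0 sum_if_0 cong: if_cong)
  also have "\<dots> = (\<Sum>c\<in>UNIV. \<Sum>b'\<in>UNIV. \<Sum>c'\<in>UNIV. \<Sum>b\<in>UNIV.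
      R (i, c) * S (b', c') * ?m c c' k * (hunit H b * ?m b b' j))"
    by (subst sum.swap) (intro sum.cong refl sum_rotate)
  also have "\<dots> = (\<Sum>c\<in>UNIV. \<Sum>b'\<in>UNIV. \<Sum>c'\<in>UNIV.
      R (i, c) * S (b', c') * ?m c c' k * (if b' = j then 1 else 0))"
    by (simp only: sum_distrib_left[symmetric] l)
  also have "\<dots> = (\<Sum>c\<in>UNIV. \<Sum>c'\<in>UNIV. R (i, c) * S (j, c') * ?m c c' k)"
    by (simp add: if_mult_0 sum_if_0 cong: if_cong)
  also have "\<dots> = hmul H (\<lambda>c. R (i, c)) (\<lambda>c. S (j, c)) k"
    by (simp add: bilinear_apply[OF assms(1), of "\<lambda>c. R (i, c)" "\<lambda>c. S (j, c)"])
  finally show "?L = hmul H (\<lambda>c. R (i, c)) (\<lambda>c. S (j, c)) k" .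
  have "?L' = (\<Sum>a\<in>UNIV. \<Sum>b\<in>UNIV. \<Sum>c\<in>UNIV. \<Sum>a'\<in>UNIV. \<Sum>b'\<in>UNIV. \<Sum>c'\<in>UNIV.
      R (a, c) * S (a', b') * ?m a a' i * (hunit H b * ?m b b' j) * (hunit H c' * ?m c c' k))"
    by (simp add: mul3 leg13_def leg12_def mult_ac)
  also have "\<dots> = (\<Sum>a\<in>UNIV. \<Sum>b\<in>UNIV. \<Sum>c\<in>UNIV. \<Sum>a'\<in>UNIV. \<Sum>b'\<in>UNIV.
      R (a, c) * S (a', b') * ?m a a' i * (hunit H b * ?m b b' j) * (if c = k then 1 else 0))"
    by (simp only: sum_distrib_left[symmetric] r)
  also have "\<dots> = (\<Sum>a\<in>UNIV. \<Sum>b\<in>UNIV. \<Sum>a'\<in>UNIV. \<Sum>b'\<in>UNIV.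
      R (a, k) * S (a', b') * ?m a a' i * (hunit H b * ?m b b' j))"
    by (simp add: if_mult_0 sum_if_0 cong: if_cong)
  also have "\<dots> = (\<Sum>a\<in>UNIV. \<Sum>a'\<in>UNIV. \<Sum>b'\<in>UNIV. \<Sum>b\<in>UNIV.
      R (a, k) * S (a', b') * ?m a a' i * (hunit H b * ?m b b' j))"
    by (intro sum.cong refl sum_rotate)
  also have "\<dots> = (\<Sum>a\<in>UNIV. \<Sum>a'\<in>UNIV. \<Sum>b'\<in>UNIV.
      R (a, k) * S (a', b') * ?m a a' i * (if b' = j then 1 else 0))"
    by (simp only: sum_distrib_left[symmetric] l)
  also have "\<dots> = (\<Sum>a\<in>UNIV. \<Sum>a'\<in>UNIV. R (a, k) * S (a', j) * ?m a a' i)"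
    by (simp add: if_mult_0 sum_if_0 cong: if_cong)
  also have "\<dots> = hmul H (\<lambda>a. R (a, k)) (\<lambda>a. S (a, j)) i"
    by (simp add: bilinear_apply[OF assms(1), of "\<lambda>a. R (a, k)" "\<lambda>a. S (a, j)"])
  finally show "?L' = hmul H (\<lambda>a. R (a, k)) (\<lambda>a. S (a, j)) i" .
qed

text \<open>
  The axioms, read off at basis elements: the two coproduct axioms, the two counit axioms,
  and the commutation axiom for \<open>e\<^sub>g\<^sub>s \<bowtie> 1\<close> alone.
\<close>
lemma quasitriangular_double_coordinates:
  fixes R :: "('g::{finite,group_add} \<times> 'g) \<times> ('g \<times> 'g) \<Rightarrow> 'k::field"
  assumes "quasitriangular double R"
  shows "(if h = h' then R ((t + s, h), (w, z)) else 0) =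
      (\<Sum>k\<in>UNIV. R ((s, h), (w, k)) * R ((t, h'), (- k + w + k, - k + z)))"
    and "(if h = h' then R ((g, y), (t + s, h)) else 0) =
      (\<Sum>k\<in>UNIV. R ((g, k), (t, h')) * R ((- k + g + k, - k + y), (s, h)))"
    and "(\<Sum>y\<in>UNIV. R ((0, y), (s, z))) = (if z = 0 then 1 else 0)"
    and "(\<Sum>z\<in>UNIV. R ((g, y), (0, z))) = (if y = 0 then 1 else 0)"
    and "R ((g, y), (s, z)) \<noteq> 0 \<Longrightarrow> (- z + s + z) + (- y + g + y) = g + s"
proof -
  note R = assms[unfolded quasitriangular_def Let_def]
  note legs = tensor_mul_legs[OF is_bilinear_double double_unit]
  have *: "(\<Sum>b\<in>UNIV. f b * hcomul double (bas b) ((s, h), (t, h'))) =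
      (if h = h' then f (t + s, h) else 0)" for f :: "'g \<times> 'g \<Rightarrow> 'k" and s h t h'
    by (simp add: double_comul_apply bas_apply sum_delta_mult)
  have "(if h = h' then R ((t + s, h), (w, z)) else 0) =
      assoc_tensor (tensor_map (hcomul double) id R) ((s, h), (t, h'), (w, z))"
    by (simp add: assoc_tensor_def tensor_map_apply bas_apply if_mult_0 * cong: if_cong)
  also have "\<dots> = (\<Sum>k\<in>UNIV. R ((s, h), (w, k)) * R ((t, h'), (- k + w + k, - k + z)))"
    using R by (simp add: legs double_mul_apply)
  finally show "(if h = h' then R ((t + s, h), (w, z)) else 0) =
      (\<Sum>k\<in>UNIV. R ((s, h), (w, k)) * R ((t, h'), (- k + w + k, - k + z)))" .
  have "(if h = h' then R ((g, y), (t + s, h)) else 0) =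
      tensor_map id (hcomul double) R ((g, y), (s, h), (t, h'))"
    by (simp add: tensor_map_apply bas_apply if_mult_0 sum_if_0 * cong: if_cong)
  also have "\<dots> = (\<Sum>k\<in>UNIV. R ((g, k), (t, h')) * R ((- k + g + k, - k + y), (s, h)))"
    using R by (simp add: legs double_mul_apply)
  finally show "(if h = h' then R ((g, y), (t + s, h)) else 0) =
      (\<Sum>k\<in>UNIV. R ((g, k), (t, h')) * R ((- k + g + k, - k + y), (s, h)))" .
  have "(\<Sum>i\<in>UNIV. hcounit double (bas i) * R (i, (s, z))) = hunit double (s, z)"
    by (rule fun_cong[OF R[THEN conjunct2, THEN conjunct2, THEN conjunct1]])
  then show "(\<Sum>y\<in>UNIV. R ((0, y), (s, z))) = (if z = 0 then 1 else 0)"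
    by (simp add: sum_UNIV_prod double_counit_bas double_unit_apply if_mult_0 sum_if_0
        cong: if_cong)
  have "(\<Sum>j\<in>UNIV. R ((g, y), j) * hcounit double (bas j)) = hunit double (g, y)"
    by (rule fun_cong[OF R[THEN conjunct2, THEN conjunct2, THEN conjunct2, THEN conjunct1]])
  then show "(\<Sum>z\<in>UNIV. R ((g, y), (0, z))) = (if y = 0 then 1 else 0)"
    by (simp add: sum_UNIV_prod double_counit_bas double_unit_apply if_mult_0 sum_if_0
        cong: if_cong)
  show "(- z + s + z) + (- y + g + y) = g + s" if "R ((g, y), (s, z)) \<noteq> 0"
  proof -
    (* With the element e_x for x = g s, the right-hand side keeps the coefficient at (g, s)
       unchanged, while the left-hand side multiplies it by the indicator of the claimed equation. *)
    let ?D = "hcomul double (bas (g + s, 0)) :: _ \<Rightarrow> 'k"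
    have D: "?D ((a, k), (b, l)) = (if b + a = g + s then 1 else 0) *
        (if k = 0 then 1 else 0) * (if l = 0 then 1 else 0)" for a k b l
      by (auto simp: double_comul_apply bas_apply)
    have "tensor_mul (hmul double) (hmul double) R ?D ((g, y), (s, z)) =
        tensor_mul (hmul double) (hmul double) (flip ?D) R ((g, y), (s, z))"
      using R by simp
    moreover have "(- k + y = 0) = (k = y)" for k y :: 'g
      by (metis add.inverse_unique add_minus_cancel add.right_neutral left_minus)
    ultimately have "R ((g, y), (s, z)) * (if (- z + s + z) + (- y + g + y) = g + s then 1 else 0) =
        R ((g, y), (s, z))"
      by (simp add: tensor_mul_double_apply D flip_def if_mult_0 sum_if_0 cong: if_cong)
    with that show ?thesis by (simp split: if_splits)
  qed
qed

section \<open>The shape of a quasitriangular structure\<close>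

definition central :: "'g::group_add \<Rightarrow> bool"
  where "central c \<longleftrightarrow> (\<forall>x. c + x = x + c)"

text \<open>
  The normal form of \<open>R\<close> in terms of its components \<open>u(f) = f \<circ> \<mu>\<close>, \<open>r\<close>, \<open>p\<close> (with matrix \<open>P\<close>)
  and \<open>v(g) = \<nu>(g)\<close>. The sums over \<open>P\<close> say that \<open>p\<close> preserves counit and unit; together with
  the normalisations at \<open>0\<close> they let each component be isolated from the product.
\<close>
definition component_form ::
  "(('g::{finite,group_add} \<times> 'g) \<times> ('g \<times> 'g) \<Rightarrow> 'k::field) \<Rightarrow>
    ('g \<Rightarrow> 'g) \<Rightarrow> ('g \<Rightarrow> 'g \<Rightarrow> 'k) \<Rightarrow> ('g \<Rightarrow> 'g \<Rightarrow> 'k) \<Rightarrow> ('g \<Rightarrow> 'g) \<Rightarrow> bool"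
  where "component_form R \<mu> r P \<nu> \<longleftrightarrow>
    (\<forall>g y s z. R ((g, y), (s, z)) = r g s * P (y - \<mu> s) (z - \<nu> g)) \<and>
    (\<forall>y. (\<Sum>z\<in>UNIV. P y z) = (if y = 0 then 1 else 0)) \<and>
    (\<forall>z. (\<Sum>y\<in>UNIV. P y z) = (if z = 0 then 1 else 0)) \<and>
    (\<forall>s. r 0 s = 1) \<and> (\<forall>g. r g 0 = 1) \<and> \<mu> 0 = 0 \<and> \<nu> 0 = 0"

text \<open>
  Equivalently, an algebra map from \<open>\<Bbbk>\<^sup>G\<close> to \<open>\<Bbbk>\<close> is evaluation at a point.
\<close>
lemma orthogonal_idempotents_delta:
  fixes u :: "'g::finite \<Rightarrow> 'k::field"
  assumes orth: "\<And>h h'. u h * u h' = (if h = h' then u h else 0)" and one: "(\<Sum>h\<in>UNIV. u h) = 1"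
  shows "\<exists>m. \<forall>h. u h = (if h = m then 1 else 0)"
proof -
  obtain m where m: "u m \<noteq> 0"
    using one by (metis sum.neutral zero_neq_one)
  with orth[of m m] have "u m = 1" by simp
  with orth[of _ m] have "\<forall>h. u h = (if h = m then 1 else 0)"
    by (metis mult.right_neutral)
  then show ?thesis ..
qed

lemma minus_add_eq_iff: "- k + y = m \<longleftrightarrow> k = y - m" for k :: "'g::group_add"
  by (metis add.assoc add_diff_cancel diff_add_cancel minus_add_cancel add_minus_cancel)

text \<open>
  The argument first treats the coefficients with \<open>g\<close> or \<open>s\<close> trivial, where commutation
  removes the conjugations. It produces \<open>\<mu>\<close> and \<open>\<nu>\<close>, and \<open>P\<close> turns out to be supported on central
  elements. The axioms with one trivial argument then express every coefficient through
  \<open>P\<close> and the marginal \<open>T\<close>, which itself is concentrated at \<open>\<nu>(g)\<close>.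
\<close>
lemma quasitriangular_double_component_form:
  fixes R :: "('g::{finite,group_add} \<times> 'g) \<times> ('g \<times> 'g) \<Rightarrow> 'k::field"
  assumes "quasitriangular double R"
  obtains \<mu> r P \<nu> where "component_form R \<mu> r P \<nu>"
proof -
  define \<rho> where "\<rho> g y s z = R ((g, y), (s, z))" for g y s z
  note coords = quasitriangular_double_coordinates[OF assms, folded \<rho>_def]
  note A1 = coords(1) and A2 = coords(2) and A3 = coords(3) and A4 = coords(4)
  define P where "P y z = \<rho> 0 y 0 z" for y z
  define U where "U y s = (\<Sum>z\<in>UNIV. \<rho> 0 y s z)" for y s
  define V where "V g z = (\<Sum>y\<in>UNIV. \<rho> g y 0 z)" for g z
  define T where "T g s z = (\<Sum>y\<in>UNIV. \<rho> g y s z)" for g s z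

  have comm_z: "- z + s + z = s" if "\<rho> 0 y s z \<noteq> 0" for y s z
    using coords(5)[OF that] by simp
  have comm_y: "- y + g + y = g" if "\<rho> g y 0 z \<noteq> 0" for y g z
    using coords(5)[OF that] by simp

  (* For fixed w, the U h w are the counits of orthogonal idempotents of the group algebra. *)
  have "U h w * U h' w = (if h = h' then U h w else 0)" for h h' w
  proof -
    have "(if h = h' then \<rho> 0 h w z else 0) = (\<Sum>k\<in>UNIV. \<rho> 0 h w k * \<rho> 0 h' w (- k + z))" for z
    proof -
      have "\<rho> 0 h w k * \<rho> 0 h' (- k + w + k) (- k + z) = \<rho> 0 h w k * \<rho> 0 h' w (- k + z)" for k
        using comm_z[of h w k] by (cases "\<rho> 0 h w k = 0") simp_all
      with A1[of h h' 0 0 w z] show ?thesis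
        by (simp only: add_0_left add_0_right)
    qed
    then have "(\<Sum>z\<in>UNIV. if h = h' then \<rho> 0 h w z else 0) =
        (\<Sum>z\<in>UNIV. \<Sum>k\<in>UNIV. \<rho> 0 h w k * \<rho> 0 h' w (- k + z))"
      by simp
    also have "\<dots> = (\<Sum>k\<in>UNIV. \<rho> 0 h w k * (\<Sum>z\<in>UNIV. \<rho> 0 h' w (- k + z)))"
      by (subst sum.swap) (simp add: sum_distrib_left)
    also have "\<dots> = U h w * U h' w"
      by (simp add: sum_translate(1) U_def sum_distrib_right)
    finally show ?thesis by (simp only: sum_if_0 U_def)
  qed
  moreover have "(\<Sum>h\<in>UNIV. U h w) = 1" for w
    unfolding U_def by (subst sum.swap) (simp add: A3)
  ultimately have "\<exists>m. \<forall>h. U h w = (if h = m then 1 else 0)" for w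
    by (rule orthogonal_idempotents_delta)
  then obtain \<mu> where U: "U h w = (if h = \<mu> w then 1 else 0)" for h w
    by metis

  (* The same for the other leg of R. *)
  have "V g h * V g h' = (if h = h' then V g h else 0)" for g h h'
  proof -
    have "(if h = h' then \<rho> g y 0 h else 0) = (\<Sum>k\<in>UNIV. \<rho> g k 0 h' * \<rho> g (- k + y) 0 h)" for y
    proof -
      have "\<rho> g k 0 h' * \<rho> (- k + g + k) (- k + y) 0 h = \<rho> g k 0 h' * \<rho> g (- k + y) 0 h" for k
        using comm_y[of g k h'] by (cases "\<rho> g k 0 h' = 0") simp_all
      with A2[of h h' g y 0 0] show ?thesis
        by (simp only: add_0_left add_0_right)
    qed
    then have "(\<Sum>y\<in>UNIV. if h = h' then \<rho> g y 0 h else 0) =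
        (\<Sum>y\<in>UNIV. \<Sum>k\<in>UNIV. \<rho> g k 0 h' * \<rho> g (- k + y) 0 h)"
      by simp
    also have "\<dots> = (\<Sum>k\<in>UNIV. \<rho> g k 0 h' * (\<Sum>y\<in>UNIV. \<rho> g (- k + y) 0 h))"
      by (subst sum.swap) (simp add: sum_distrib_left)
    also have "\<dots> = V g h' * V g h"
      by (simp add: sum_translate(1)[of "\<lambda>y. \<rho> g y 0 h"] V_def sum_distrib_right)
    finally show ?thesis by (simp only: sum_if_0 V_def mult.commute)
  qed
  moreover have "(\<Sum>h\<in>UNIV. V g h) = 1" for g
    unfolding V_def by (subst sum.swap) (simp add: A4)
  ultimately have "\<exists>m. \<forall>h. V g h = (if h = m then 1 else 0)" for g
    by (rule orthogonal_idempotents_delta)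
  then obtain \<nu> where V: "V g z = (if z = \<nu> g then 1 else 0)" for g z
    by metis

  (* The left-hand sides of the coproduct axioms vanish unless h = h'. Summing over one of these
     two indices turns a factor on the right into U or V, that is, into a delta function,
     and what is left is a translate of P. *)
  have \<rho>0_left: "\<rho> 0 y t h = P (- \<mu> t + y) h" for y t h
  proof -
    have "\<rho> 0 y t h = (\<Sum>h'\<in>UNIV. if h = h' then \<rho> 0 y (t + 0) h else 0)"
      by simp
    also have "\<dots> = (\<Sum>h'\<in>UNIV. \<Sum>k\<in>UNIV. \<rho> 0 k t h' * \<rho> 0 (- k + y) 0 h)"
      by (simp only: A2) simp
    also have "\<dots> = (\<Sum>k\<in>UNIV. U k t * \<rho> 0 (- k + y) 0 h)"
      by (subst sum.swap) (simp add: U_def sum_distrib_right)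
    finally show ?thesis by (simp add: U P_def if_mult_0 cong: if_cong)
  qed
  have \<rho>0_right: "\<rho> 0 y s h' = P (y - \<mu> s) h'" for y s h'
  proof -
    have "\<rho> 0 y s h' = (\<Sum>h\<in>UNIV. if h = h' then \<rho> 0 y (0 + s) h else 0)"
      by simp
    also have "\<dots> = (\<Sum>h\<in>UNIV. \<Sum>k\<in>UNIV. \<rho> 0 k 0 h' * \<rho> 0 (- k + y) s h)"
      by (simp only: A2) simp
    also have "\<dots> = (\<Sum>k\<in>UNIV. \<rho> 0 k 0 h' * U (- k + y) s)"
      by (subst sum.swap) (simp add: U_def sum_distrib_left)
    finally show ?thesis by (simp add: U P_def minus_add_eq_iff if_mult_0 cong: if_cong)
  qed
  have \<rho>_0: "\<rho> t h 0 z = P h (z - \<nu> t)" for t h z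
  proof -
    have "\<rho> t h 0 z = (\<Sum>h'\<in>UNIV. if h = h' then \<rho> (t + 0) h 0 z else 0)"
      by simp
    also have "\<dots> = (\<Sum>h'\<in>UNIV. \<Sum>k\<in>UNIV. \<rho> 0 h 0 k * \<rho> t h' 0 (- k + z))"
      by (simp only: A1) simp
    also have "\<dots> = (\<Sum>k\<in>UNIV. \<rho> 0 h 0 k * V t (- k + z))"
      by (subst sum.swap) (simp add: V_def sum_distrib_left)
    finally show ?thesis by (simp add: V P_def minus_add_eq_iff if_mult_0 cong: if_cong)
  qed
  (* A nonzero P b c reappears in the coefficients for every s, and for every g, so that
     c commutes with every s and b with every g. *)
  have central: "central b \<and> central c" if "P b c \<noteq> 0" for b c
  proof
    have "- c + s + c = s" for s
      using comm_z[of "\<mu> s + b" s c] that by (simp add: \<rho>0_left add.assoc[symmetric])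
    then have "s + c = c + s" for s
      by (metis add.assoc add_minus_cancel)
    then show "central c" by (simp add: central_def)
    have "- b + g + b = g" for g
      using comm_y[of g b "c + \<nu> g"] that by (simp add: \<rho>_0)
    then have "g + b = b + g" for g
      by (metis add.assoc add_minus_cancel)
    then show "central b" by (simp add: central_def)
  qed
  have central_y: "- k + g + k = g" if "P k c \<noteq> 0" for k c g
    using central[OF that] by (metis add.assoc central_def minus_add_cancel)
  have central_z: "- k + g + k = g" if "P c k \<noteq> 0" for k c g
    using central[OF that] by (metis add.assoc central_def minus_add_cancel)
  have \<nu>0: "\<nu> 0 = 0" and \<mu>0: "\<mu> 0 = 0"
    using V[of 0 0] U[of 0 0] A3[of 0 0] A4[of 0 0] by (auto simp: V_def U_def split: if_splits)
  have P_left: "(\<Sum>z\<in>UNIV. P y z) = (if y = 0 then 1 else 0)" for y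
    by (simp add: P_def A4)
  have P_right: "(\<Sum>y\<in>UNIV. P y z) = (if z = 0 then 1 else 0)" for z
    by (simp add: P_def A3)

  (* Here k ranges over the support of P, hence over central elements, so the conjugation by k
     in the second coproduct axiom has disappeared. *)
  have T: "T g s h = (if h = \<nu> g then T g s (\<nu> g) else 0)" for g s h
  proof -
    have eq: "(if h = h' then \<rho> g y s h else 0) = (\<Sum>k\<in>UNIV. P k (h' - \<nu> g) * \<rho> g (- k + y) s h)"
      for y h'
    proof -
      have "P k c * \<rho> (- k + g + k) (- k + y) s h = P k c * \<rho> g (- k + y) s h" for k c
        using central_y[of k c g] by (cases "P k c = 0") simp_all
      with A2[of h h' g y 0 s] show ?thesis
        by (simp only: \<rho>_0 add_0_left add_0_right)
    qed
    have "(\<Sum>y\<in>UNIV. if h = \<nu> g then \<rho> g y s h else 0) =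
        (\<Sum>y\<in>UNIV. \<Sum>k\<in>UNIV. P k 0 * \<rho> g (- k + y) s h)"
      by (simp only: eq diff_self)
    also have "\<dots> = (\<Sum>k\<in>UNIV. P k 0 * (\<Sum>y\<in>UNIV. \<rho> g (- k + y) s h))"
      by (subst sum.swap) (simp add: sum_distrib_left)
    also have "\<dots> = T g s h"
      by (simp add: sum_translate(1)[of "\<lambda>y. \<rho> g y s h"] T_def flip: sum_distrib_right) (simp add: P_right)
    finally show ?thesis by (auto simp: T_def)
  qed
  have shape: "\<rho> g y s z = T g s (\<nu> g) * P (y - \<mu> s) (z - \<nu> g)" for g y s z
  proof -
    have eq: "(if y = h' then \<rho> g y s z else 0) =
        (\<Sum>k\<in>UNIV. P (y - \<mu> s) k * \<rho> g h' s (- k + z))" for h'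
    proof -
      have "P c k * \<rho> g h' (- k + s + k) (- k + z) = P c k * \<rho> g h' s (- k + z)" for k c
        using central_z[of c k s] by (cases "P c k = 0") simp_all
      with A1[of y h' g 0 s z] show ?thesis
        by (simp only: \<rho>0_right add_0_left add_0_right)
    qed
    have "\<rho> g y s z = (\<Sum>h'\<in>UNIV. if y = h' then \<rho> g y s z else 0)"
      by simp
    also have "\<dots> = (\<Sum>k\<in>UNIV. P (y - \<mu> s) k * T g s (- k + z))"
      unfolding eq by (subst sum.swap) (simp add: T_def sum_distrib_left)
    also have "\<dots> = (\<Sum>k\<in>UNIV. P (y - \<mu> s) k * (if k = z - \<nu> g then T g s (\<nu> g) else 0))"
      by (subst T) (simp add: minus_add_eq_iff)
    finally show ?thesis by (simp add: if_mult_0 mult.commute cong: if_cong)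
  qed
  have "T 0 s (\<nu> 0) = 1" for s
    by (simp add: \<nu>0 T_def A3)
  moreover have "T g 0 (\<nu> g) = 1" for g
    using V[of g "\<nu> g"] by (simp add: T_def V_def)
  ultimately have "component_form R \<mu> (\<lambda>g s. T g s (\<nu> g)) P \<nu>"
    using shape P_left P_right \<mu>0 \<nu>0 by (simp add: component_form_def \<rho>_def)
  then show ?thesis by (rule that)
qed

lemma component_form_components:
  assumes "component_form R \<mu> r P \<nu>"
  shows "components R =
    (\<lambda>f s. f (\<mu> s), \<lambda>z s. \<Sum>g\<in>UNIV. z g * r g s,
     \<lambda>f z. \<Sum>y\<in>UNIV. f y * P y z, \<lambda>z h. \<Sum>g\<in>UNIV. z g * (if h = \<nu> g then 1 else 0))"
proof -
  note R = assms[unfolded component_form_def, THEN conjunct1, rule_format]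
  note r0 = assms[unfolded component_form_def, THEN conjunct2]
  have marg: "(\<Sum>z\<in>UNIV. P y (z - c)) = (if y = 0 then 1 else 0)"
    "(\<Sum>y\<in>UNIV. P (y - c) z) = (if z = 0 then 1 else 0)" for y z c
    using r0 by (simp_all add: sum_translate(2)[of "P y"] sum_translate(2)[of "\<lambda>y. P y z"])
  have u: "id_eps (F_map R (f \<sharp> bas 0)) s = f (\<mu> s)" for f s
  proof -
    have "id_eps (F_map R (f \<sharp> bas 0)) s = (\<Sum>z\<in>UNIV. \<Sum>y\<in>UNIV. f y * P (y - \<mu> s) z)"
      using r0 by (simp add: id_eps_def F_map_def sum_UNIV_prod hash_def bas_apply R
          if_mult_0 sum_if_0 cong: if_cong)
    also have "\<dots> = (\<Sum>y\<in>UNIV. f y * (if y = \<mu> s then 1 else 0))"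
      using r0 by (subst sum.swap) (simp flip: sum_distrib_left)
    finally show ?thesis by (simp add: sum_delta_mult)
  qed
  have r: "id_eps (F_map R (1 \<sharp> z)) s = (\<Sum>g\<in>UNIV. z g * r g s)" for z s
  proof -
    have "id_eps (F_map R (1 \<sharp> z)) s =
        (\<Sum>h\<in>UNIV. \<Sum>g\<in>UNIV. \<Sum>y\<in>UNIV. z g * r g s * P (y - \<mu> s) (h - \<nu> g))"
      by (simp add: id_eps_def F_map_def sum_UNIV_prod hash_def R mult.assoc)
    also have "\<dots> = (\<Sum>g\<in>UNIV. \<Sum>h\<in>UNIV. \<Sum>y\<in>UNIV. z g * r g s * P (y - \<mu> s) (h - \<nu> g))"
      by (rule sum.swap)
    also have "\<dots> = (\<Sum>g\<in>UNIV. \<Sum>h\<in>UNIV. z g * r g s * (if h = \<nu> g then 1 else 0))"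
      by (simp add: marg flip: sum_distrib_left)
    finally show ?thesis by (simp add: sum_delta_mult)
  qed
  have p: "ev1_id (F_map R (f \<sharp> bas 0)) z = (\<Sum>y\<in>UNIV. f y * P y z)" for f z
    using r0 by (simp add: ev1_id_def F_map_def sum_UNIV_prod hash_def bas_apply R
        if_mult_0 sum_if_0 cong: if_cong)
  have v: "ev1_id (F_map R (1 \<sharp> z)) h = (\<Sum>g\<in>UNIV. z g * (if h = \<nu> g then 1 else 0))" for z h
    using r0 by (simp add: ev1_id_def F_map_def sum_UNIV_prod hash_def R flip: sum_distrib_left)
  show ?thesis
    by (simp add: components_def fun_eq_iff u r p v)
qed

text \<open>
  Each of \<open>\<mu>\<close>, \<open>r\<close>, \<open>P\<close>, \<open>\<nu>\<close> can be recovered by evaluating the components at basis elements.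
\<close>
lemma components_determine:
  assumes R: "quasitriangular double R" and S: "quasitriangular double S"
    and eq: "components R = components (S :: _ \<Rightarrow> 'k::field)"
  shows "R = S"
proof -
  obtain \<mu> r P \<nu> where 1: "component_form R \<mu> r P \<nu>"
    by (rule quasitriangular_double_component_form[OF R])
  obtain \<mu>' r' P' \<nu>' where 2: "component_form S \<mu>' r' P' \<nu>'"
    by (rule quasitriangular_double_component_form[OF S])
  have c: "f (\<mu> s) = f (\<mu>' s)" "(\<Sum>g\<in>UNIV. z g * r g s) = (\<Sum>g\<in>UNIV. z g * r' g s)"
    "(\<Sum>y\<in>UNIV. f y * P y t) = (\<Sum>y\<in>UNIV. f y * P' y t)"
    "(\<Sum>g\<in>UNIV. z g * (if h = \<nu> g then 1 else 0)) = (\<Sum>g\<in>UNIV. z g * (if h = \<nu>' g then 1 else 0))"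
    for f z :: "'a \<Rightarrow> 'k" and s t h
    using eq unfolding component_form_components[OF 1] component_form_components[OF 2]
    by (simp_all add: fun_eq_iff)
  have "\<mu> s = \<mu>' s" for s
    using c(1)[of "bas (\<mu> s)" s] by (simp add: bas_apply split: if_splits)
  moreover have "r g s = r' g s" for g s
    using c(2)[of "bas g" s] by (simp add: bas_apply sum_delta_mult)
  moreover have "P y t = P' y t" for y t
    using c(3)[of "bas y" t] by (simp add: bas_apply sum_delta_mult)
  moreover have "\<nu> g = \<nu>' g" for g
    using c(4)[of "bas g" "\<nu> g"] by (simp add: bas_apply sum_delta_mult split: if_splits)
  ultimately show ?thesis
    using 1 2 by (simp add: component_form_def fun_eq_iff)
qed

section \<open>Convolution in coordinates\<close>

lemma fun_co_comul_apply: "hcomul fun_co f (s, t) = (f (t + s) :: 'k::field)"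
proof -
  have "bas s' s * bas (x - s') t = (if s' = s then (if x = t + s then 1 else 0) else 0 :: 'k)"
    for s' x
    by (auto simp: bas_apply eq_diff_iff)
  then show ?thesis
    by (simp add: fun_co_def lin_ext_apply sum_fun_apply tensor_apply if_mult_0 cong: if_cong)
qed

lemma grp_alg_mul_apply: "hmul grp_alg a b z = (\<Sum>c\<in>UNIV. a c * b (- c + z) :: 'k::field)"
proof -
  have "(z = c + c') = (c' = - c + z)" for c c' :: 'a
    by (metis add.assoc add.left_neutral left_minus right_minus)
  then show ?thesis
    by (simp add: grp_alg_def bilin_ext_apply bas_apply if_mult_0 sum_if_0 cong: if_cong)
qed

lemma is_linear_fun_co_comul: "is_linear (hcomul fun_co)"
  by (simp add: fun_co_def is_linear_lin_ext)

lemma is_linear_grp_alg_comul: "is_linear (hcomul grp_alg)"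
  by (simp add: grp_alg_def is_linear_lin_ext)

lemma is_linear_convolution:
  "is_linear (hcomul C) \<Longrightarrow> is_linear (\<phi> \<boxplus>\<^bsub>C,A\<^esub> \<psi>)"
  unfolding convolution_def by (rule is_linear_comp[OF is_linear_lin_ext])

lemmas is_linear_convolutions =
  is_linear_convolution[OF is_linear_fun_co_comul] is_linear_convolution[OF is_linear_grp_alg_comul]

text \<open>
  A coproduct of \<open>\<Bbbk>\<^sup>G\<^sup> \<^sup>c\<^sup>o\<close> turns into a translation of the argument, so iterated convolutions
  unfold to nested applications of the factors without any sums over coproducts.
\<close>
lemma convolution_fun_fun:
  assumes "is_linear \<phi>" "is_linear \<psi>"
  shows "(\<phi> \<boxplus>\<^bsub>fun_co,fun_co\<^esub> \<psi>) f s = \<psi> (\<lambda>b. \<phi> (\<lambda>a. f (b + a)) s) s"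
proof -
  have "(\<phi> \<boxplus>\<^bsub>fun_co,fun_co\<^esub> \<psi>) f s =
      (\<Sum>a\<in>UNIV. \<Sum>b\<in>UNIV. f (b + a) * (\<phi> (bas a) s * \<psi> (bas b) s))"
    by (simp add: convolution_def lin_ext_apply sum_UNIV_prod fun_co_comul_apply)
      (simp add: fun_co_def)
  also have "\<dots> = (\<Sum>b\<in>UNIV. (\<Sum>a\<in>UNIV. f (b + a) * \<phi> (bas a) s) * \<psi> (bas b) s)"
    by (subst sum.swap) (simp add: sum_distrib_right mult.assoc)
  also have "\<dots> = \<psi> (\<lambda>b. \<phi> (\<lambda>a. f (b + a)) s) s"
    by (simp only: linear_apply[OF assms(1), symmetric] linear_apply[OF assms(2), symmetric])
  finally show ?thesis .
qed

lemma convolution_grp_bas: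
  fixes \<phi> \<psi> :: "('g::{finite,group_add} \<Rightarrow> 'k::field) \<Rightarrow> ('c \<Rightarrow> 'k)"
  shows "(\<phi> \<boxplus>\<^bsub>grp_alg,A\<^esub> \<psi>) (bas g) = hmul A (\<phi> (bas g)) (\<psi> (bas g))"
proof -
  have "hcomul grp_alg (bas g) = (bas (g, g) :: _ \<Rightarrow> 'k)"
    by (simp add: grp_alg_def lin_ext_bas bas_pair)
  then show ?thesis by (simp add: convolution_def lin_ext_bas)
qed

text \<open>
  The pairing of a matrix \<open>K\<close> with a test function of both indices. Keeping each matrix together
  with its two summation indices reduces the manipulation of the many sums that arise
  from the identities to exchanging, merging and collapsing such pairings.
\<close>
definition kern_sum ::
  "('a::finite \<Rightarrow> 'b::finite \<Rightarrow> 'k::field) \<Rightarrow> ('a \<Rightarrow> 'b \<Rightarrow> 'k) \<Rightarrow> 'k"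
  where "kern_sum K t = (\<Sum>x\<in>UNIV. \<Sum>y\<in>UNIV. K x y * t x y)"

lemma kern_sum_mult:
  "kern_sum K t * c = kern_sum K (\<lambda>x y. t x y * c)"
  "c * kern_sum K t = kern_sum K (\<lambda>x y. c * t x y)"
  by (simp_all add: kern_sum_def sum_distrib_left sum_distrib_right mult_ac)

lemma kern_sum_sum: "(\<Sum>i\<in>A. kern_sum K (t i)) = kern_sum K (\<lambda>x y. \<Sum>i\<in>A. t i x y)"
proof -
  have "(\<Sum>i\<in>A. kern_sum K (t i)) = (\<Sum>x\<in>UNIV. \<Sum>y\<in>UNIV. \<Sum>i\<in>A. K x y * t i x y)"
    unfolding kern_sum_def by (rule sum_rotate)
  then show ?thesis by (simp add: kern_sum_def sum_distrib_left)
qed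

lemma kern_sum_swap:
  "kern_sum K (\<lambda>x y. kern_sum L (\<lambda>x' y'. t x y x' y')) =
    kern_sum L (\<lambda>x' y'. kern_sum K (\<lambda>x y. t x y x' y'))"
  by (subst (1) kern_sum_def) (simp only: kern_sum_mult kern_sum_sum kern_sum_def[of K])

lemma kern_sum_cong:
  assumes "\<And>x y. K x y \<noteq> 0 \<Longrightarrow> t x y = t' x y"
  shows "kern_sum K t = kern_sum K t'"
  unfolding kern_sum_def
proof (intro sum.cong refl)
  fix x y
  show "K x y * t x y = K x y * t' x y"
    using assms[of x y] by (cases "K x y = 0") auto
qed

text \<open>
  The rows of the matrix of a counit-preserving map sum to a delta function. A test function
  that ignores the second index is then simply evaluated.
\<close>
lemma kern_sum_counit:
  assumes "\<And>x. (\<Sum>y\<in>UNIV. K x y) = (if x = a then 1 else 0)"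
  shows "kern_sum K (\<lambda>x y. t x) = t a"
  by (simp add: kern_sum_def assms if_mult_0 flip: sum_distrib_right cong: if_cong)

text \<open>
  The hypothesis says that \<open>e\<^sub>x \<mapsto> K x\<close> is multiplicative from functions to the group algebra:
  the images of distinct \<open>e\<^sub>x\<close> annihilate each other, and each one is idempotent.
\<close>
lemma kern_sum_merge:
  fixes K :: "'a::finite \<Rightarrow> 'g::{finite,group_add} \<Rightarrow> 'k::field"
  assumes "\<And>x x' w. (\<Sum>c\<in>UNIV. K x c * K x' (- c + w)) = (if x = x' then K x w else 0)"
  shows "kern_sum K (\<lambda>x w. kern_sum K (\<lambda>x' w'. t x x' (w + w'))) = kern_sum K (\<lambda>x w. t x x w)"
proof -
  have "kern_sum K (\<lambda>x w. kern_sum K (\<lambda>x' w'. t x x' (w + w'))) =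
      (\<Sum>x\<in>UNIV. \<Sum>w\<in>UNIV. \<Sum>x'\<in>UNIV. \<Sum>w'\<in>UNIV. K x w * K x' w' * t x x' (w + w'))"
    by (simp add: kern_sum_def sum_distrib_left mult.assoc)
  also have "\<dots> = (\<Sum>x\<in>UNIV. \<Sum>w\<in>UNIV. \<Sum>x'\<in>UNIV. \<Sum>v\<in>UNIV. K x w * K x' (- w + v) * t x x' v)"
  proof -
    have "(\<Sum>w'\<in>UNIV. K x w * K x' w' * t x x' (w + w')) =
        (\<Sum>v\<in>UNIV. K x w * K x' (- w + v) * t x x' v)" for x x' w
      using sum_translate(1)[of "\<lambda>v. K x w * K x' (- w + v) * t x x' v" w]
      by (simp add: add.assoc[symmetric])
    then show ?thesis by (simp only:)
  qed
  also have "\<dots> = (\<Sum>x\<in>UNIV. \<Sum>x'\<in>UNIV. \<Sum>v\<in>UNIV. \<Sum>w\<in>UNIV. K x w * K x' (- w + v) * t x x' v)"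
    by (intro sum.cong refl sum_rotate)
  also have "\<dots> = (\<Sum>x\<in>UNIV. \<Sum>x'\<in>UNIV. \<Sum>v\<in>UNIV. (if x = x' then K x v else 0) * t x x' v)"
    by (simp only: sum_distrib_right[symmetric] assms)
  also have "\<dots> = kern_sum K (\<lambda>x w. t x x w)"
    by (simp add: kern_sum_def if_mult_0 sum_if_0 cong: if_cong)
  finally show ?thesis .
qed

lemma kern_sum_apply:
  assumes "is_linear \<phi>"
  shows "kern_sum (\<lambda>a z. \<phi> (bas a) z) (\<lambda>a z'. f a * bas z z') = \<phi> f z"
  by (simp add: kern_sum_def linear_apply[OF assms, of f] bas_apply if_mult_0 mult.commute cong: if_cong)

text \<open>
  Testing a linear map against all functions of input and output index determines it; in this dual
  form convolution translates both indices, as in \<open>convolution_fun_fun\<close>.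
\<close>
lemma convolution_fun_grp:
  "kern_sum (\<lambda>a z. (\<phi> \<boxplus>\<^bsub>fun_co,grp_alg\<^esub> \<psi>) (bas a) z) t =
    kern_sum (\<lambda>b z. \<psi> (bas b) z) (\<lambda>b z'. kern_sum (\<lambda>a z. \<phi> (bas a) z) (\<lambda>a z. t (b + a) (z + z')))"
proof -
  have conv: "(\<phi> \<boxplus>\<^bsub>fun_co,grp_alg\<^esub> \<psi>) (bas i) z =
      (\<Sum>a\<in>UNIV. \<Sum>b\<in>UNIV. \<Sum>c\<in>UNIV. bas i (b + a) * (\<phi> (bas a) c * \<psi> (bas b) (- c + z)))" for i z
    by (simp add: convolution_def lin_ext_apply sum_UNIV_prod fun_co_comul_apply grp_alg_mul_apply
        sum_distrib_left)
  have "kern_sum (\<lambda>i z. (\<phi> \<boxplus>\<^bsub>fun_co,grp_alg\<^esub> \<psi>) (bas i) z) t =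
      (\<Sum>i\<in>UNIV. \<Sum>z\<in>UNIV. \<Sum>a\<in>UNIV. \<Sum>b\<in>UNIV. \<Sum>c\<in>UNIV.
        bas i (b + a) * (\<phi> (bas a) c * \<psi> (bas b) (- c + z)) * t i z)"
    by (simp add: kern_sum_def conv sum_distrib_right)
  also have "\<dots> = (\<Sum>i\<in>UNIV. \<Sum>a\<in>UNIV. \<Sum>b\<in>UNIV. \<Sum>z\<in>UNIV. \<Sum>c\<in>UNIV.
        bas i (b + a) * (\<phi> (bas a) c * \<psi> (bas b) (- c + z)) * t i z)"
    by (intro sum.cong refl sum_rotate)
  also have "\<dots> = (\<Sum>a\<in>UNIV. \<Sum>b\<in>UNIV. \<Sum>i\<in>UNIV. \<Sum>z\<in>UNIV. \<Sum>c\<in>UNIV.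
        bas i (b + a) * (\<phi> (bas a) c * \<psi> (bas b) (- c + z)) * t i z)"
    by (rule sum_rotate)
  also have "\<dots> = (\<Sum>a\<in>UNIV. \<Sum>b\<in>UNIV. \<Sum>z\<in>UNIV. \<Sum>c\<in>UNIV.
        \<phi> (bas a) c * \<psi> (bas b) (- c + z) * t (b + a) z)"
    by (simp add: bas_apply if_mult_0 sum_if_0 cong: if_cong)
  also have "\<dots> = (\<Sum>a\<in>UNIV. \<Sum>b\<in>UNIV. \<Sum>c\<in>UNIV. \<Sum>z\<in>UNIV.
        \<phi> (bas a) c * \<psi> (bas b) (- c + z) * t (b + a) z)"
    by (intro sum.cong refl sum.swap)
  also have "\<dots> = (\<Sum>a\<in>UNIV. \<Sum>b\<in>UNIV. \<Sum>c\<in>UNIV. \<Sum>z\<in>UNIV.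
        \<phi> (bas a) c * \<psi> (bas b) z * t (b + a) (c + z))"
  proof -
    have "(\<Sum>z\<in>UNIV. \<phi> (bas a) c * \<psi> (bas b) (- c + z) * t (b + a) z) =
        (\<Sum>z\<in>UNIV. \<phi> (bas a) c * \<psi> (bas b) z * t (b + a) (c + z))" for a b c
      using sum_translate(1)[of "\<lambda>z. \<phi> (bas a) c * \<psi> (bas b) (- c + z) * t (b + a) z" c]
      by (simp add: add.assoc[symmetric])
    then show ?thesis by (simp only:)
  qed
  also have "\<dots> = (\<Sum>a\<in>UNIV. \<Sum>c\<in>UNIV. \<phi> (bas a) c * 
      kern_sum (\<lambda>b z. \<psi> (bas b) z) (\<lambda>b z. t (b + a) (c + z)))"
    unfolding kern_sum_def
    by (intro sum.cong refl, subst sum.swap) (simp add: sum_distrib_left mult.assoc)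
  finally have "kern_sum (\<lambda>a z. (\<phi> \<boxplus>\<^bsub>fun_co,grp_alg\<^esub> \<psi>) (bas a) z) t =
    kern_sum (\<lambda>a z. \<phi> (bas a) z) (\<lambda>a c. kern_sum (\<lambda>b z. \<psi> (bas b) z) (\<lambda>b z. t (b + a) (c + z)))"
    by (simp only: kern_sum_def[of "\<lambda>a z. \<phi> (bas a) z"])
  then show ?thesis by (simp only: kern_sum_swap[of "\<lambda>a z. \<phi> (bas a) z"])
qed

lemma grp_alg_mul_pairing:
  "(\<Sum>z\<in>UNIV. hmul grp_alg a b z * q z) = (\<Sum>c'\<in>UNIV. b c' * (\<Sum>c\<in>UNIV. a c * q (c + c')) :: 'k::field)"
proof -
  have "(\<Sum>z\<in>UNIV. hmul grp_alg a b z * q z) = (\<Sum>c\<in>UNIV. \<Sum>z\<in>UNIV. a c * b (- c + z) * q z)"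
    by (subst sum.swap) (simp add: grp_alg_mul_apply sum_distrib_right)
  also have "\<dots> = (\<Sum>c\<in>UNIV. \<Sum>c'\<in>UNIV. a c * b c' * q (c + c'))"
  proof -
    have "(\<Sum>z\<in>UNIV. a c * b (- c + z) * q z) = (\<Sum>c'\<in>UNIV. a c * b c' * q (c + c'))" for c
      using sum_translate(1)[of "\<lambda>z. a c * b (- c + z) * q z" c] by (simp add: add.assoc[symmetric])
    then show ?thesis by (simp only:)
  qed
  also have "\<dots> = (\<Sum>c'\<in>UNIV. b c' * (\<Sum>c\<in>UNIV. a c * q (c + c')))"
    by (subst sum.swap) (simp add: sum_distrib_left mult_ac)
  finally show ?thesis .
qed

section \<open>Transport of the components\<close>

text \<open>
  Here \<open>A\<close> is \<open>\<alpha>\<^sup>*\<close> on group elements: \<open>f \<mapsto> \<alpha>(f)(s)\<close> is an algebra map \<open>\<Bbbk>\<^sup>G \<rightarrow> \<Bbbk>\<close>, hence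
  evaluation at a point. The matrix \<open>\<Gamma>\<close> of \<open>\<gamma>\<close> lives on central elements in both indices, because
  \<open>\<gamma>\<close> factors through restriction to one central subgroup and takes values in the group
  algebra of another.
\<close>
lemma has_matrix_coordinates:
  assumes X: "has_matrix X \<alpha> \<beta> \<gamma> \<delta>"
  obtains A :: "'g::{finite,group_add} \<Rightarrow> 'g" and b :: "'g \<Rightarrow> 'g \<Rightarrow> 'k::field"
    and \<Gamma> :: "'g \<Rightarrow> 'g \<Rightarrow> 'k" and d :: "'g \<Rightarrow> 'g"
  where "\<And>f s. \<alpha> f s = f (A s)" and "A 0 = 0"
    and "\<And>z s. \<beta> z s = (\<Sum>h\<in>UNIV. z h * b h s)"
    and "\<And>h h' s. b (h + h') s = b h s * b h' s" and "\<And>h. b h 0 = 1"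
    and "\<And>f y. \<gamma> f y = (\<Sum>x\<in>UNIV. f x * \<Gamma> x y)"
    and "\<And>x y. \<Gamma> x y \<noteq> 0 \<Longrightarrow> central x \<and> central y"
    and "\<And>x x' w. (\<Sum>c\<in>UNIV. \<Gamma> x c * \<Gamma> x' (- c + w)) = (if x = x' then \<Gamma> x w else 0)"
    and "\<And>x. (\<Sum>y\<in>UNIV. \<Gamma> x y) = (if x = 0 then 1 else 0)"
    and "\<And>z y. \<delta> z y = (\<Sum>h\<in>UNIV. z h * (if y = d h then 1 else 0))"
    and "\<And>h h'. d (h + h') = d h + d h'"
    and "\<And>x h a y. X (bas (x, h)) (a, y) = b h a * \<Gamma> (x - A a) (y - d h)"
proof -
  have \<alpha>: "hopf_hom fun_co fun_co \<alpha>" and \<gamma>: "central_factor_map \<gamma>"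
    using X by (simp_all add: has_matrix_def)
  obtain b where b: "\<And>x. character (b x)" "\<And>x y. b (x + y) = b x * b y" "\<beta> = lin_ext b"
    using X by (auto simp: has_matrix_def)
  obtain d where d: "\<And>x y. d (x + y) = d x + d y" "\<delta> = lin_ext (\<lambda>x. bas (d x))"
    using X by (auto simp: has_matrix_def)
  have X': "X (f \<otimes> bas x) = lin_ext (\<lambda>(s, t). (\<beta> (bas x) * \<alpha> (bas s)) \<otimes>
      hmul grp_alg (\<gamma> (bas t)) (\<delta> (bas x))) (hcomul fun_co f)" for f x
    using X by (simp add: has_matrix_def)

  have "\<exists>m. \<forall>h. \<alpha> (bas h) s = (if h = m then 1 else 0)" for s
  proof (rule orthogonal_idempotents_delta)
    have "bas h * bas h' = (if h = h' then bas h else (0 :: 'g \<Rightarrow> 'k))" for h h'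
      by (auto simp: bas_def fun_eq_iff)
    moreover have "\<alpha> 0 = 0"
      by (simp add: fun_eq_iff linear_apply[OF hopf_homD(1)[OF \<alpha>], of 0])
    ultimately show "\<alpha> (bas h) s * \<alpha> (bas h') s = (if h = h' then \<alpha> (bas h) s else 0)" for h h'
      using fun_cong[OF hopf_homD(2)[OF \<alpha>, of "bas h" "bas h'"], of s]
      by (auto simp: fun_co_def split: if_splits)
    show "(\<Sum>h\<in>UNIV. \<alpha> (bas h) s) = 1"
      using hopf_hom_unit_apply[OF \<alpha>, of s] by (simp add: fun_co_def)
  qed
  then obtain A where A: "\<alpha> (bas h) s = (if h = A s then 1 else 0)" for h s
    by metis
  have \<alpha>_apply: "\<alpha> f s = f (A s)" for f s
    by (simp add: linear_apply[OF hopf_homD(1)[OF \<alpha>], of f] A sum_delta_mult)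
  have A0: "A 0 = 0"
  proof -
    have "bas 0 (A 0) = (1 :: 'k)"
      using hopf_homD(5)[OF \<alpha>, of "bas 0"] by (simp add: fun_co_def \<alpha>_apply bas_apply)
    then show ?thesis by (simp add: bas_apply split: if_splits)
  qed
  have \<beta>_apply: "\<beta> z s = (\<Sum>h\<in>UNIV. z h * b h s)" for z s
    by (simp add: b lin_ext_apply)
  have b0: "b h 0 = 1" for h
    using b(1)[of h] unfolding character_def by (metis add_0 mult_cancel_left2)

  have \<gamma>hom: "hopf_hom fun_co grp_alg \<gamma>"
    using \<gamma> by (simp add: central_factor_map_def)
  note \<gamma>lin = hopf_homD(1)[OF \<gamma>hom]
  define \<Gamma> where "\<Gamma> x y = \<gamma> (bas x) y" for x y
  have \<gamma>_apply: "\<gamma> f y = (\<Sum>x\<in>UNIV. f x * \<Gamma> x y)" for f y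
    by (simp add: linear_apply[OF \<gamma>lin, of f] \<Gamma>_def)
  have \<gamma>0: "\<gamma> 0 = 0"
    by (simp add: fun_eq_iff \<gamma>_apply)
  have \<Gamma>_central: "central x \<and> central y" if nz: "\<Gamma> x y \<noteq> 0" for x y
  proof -
    obtain S T where S: "central_subgroup S" and T: "central_subgroup T"
      and restr: "\<And>f. \<gamma> f = \<gamma> (\<lambda>x. if x \<in> S then f x else 0)"
      and bij: "bij_betw \<gamma> (supported_on S) (supported_on T)"
      using \<gamma> by (auto simp: central_factor_map_def)
    have "x \<in> S"
    proof (rule ccontr)
      assume "x \<notin> S"
      then have "(\<lambda>z. if z \<in> S then bas x z else 0) = (0 :: 'g \<Rightarrow> 'k)"
        by (auto simp: fun_eq_iff bas_apply)
      with restr[of "bas x"] \<gamma>0 nz show False by (simp add: \<Gamma>_def)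
    qed
    moreover have "\<gamma> (bas x) \<in> supported_on T"
      by (subst restr, rule bij_betw_apply[OF bij]) (simp add: supported_on_def)
    with nz have "y \<in> T" by (auto simp: supported_on_def \<Gamma>_def)
    ultimately show ?thesis
      using S T by (auto simp: central_subgroup_def central_def)
  qed
  have \<Gamma>_merge: "(\<Sum>c\<in>UNIV. \<Gamma> x c * \<Gamma> x' (- c + w)) = (if x = x' then \<Gamma> x w else 0)" for x x' w
  proof -
    have "bas x * bas x' = (if x = x' then bas x else (0 :: 'g \<Rightarrow> 'k))"
      by (auto simp: bas_def fun_eq_iff)
    then show ?thesis
      using fun_cong[OF hopf_homD(2)[OF \<gamma>hom, of "bas x" "bas x'"], of w]
      by (auto simp: fun_co_def grp_alg_mul_apply \<Gamma>_def \<gamma>0 split: if_splits)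
  qed
  have \<Gamma>_counit: "(\<Sum>y\<in>UNIV. \<Gamma> x y) = (if x = 0 then 1 else 0)" for x
    using hopf_homD(5)[OF \<gamma>hom, of "bas x"]
    by (auto simp: fun_co_def grp_alg_def \<Gamma>_def bas_apply)
  have \<delta>_apply: "\<delta> z y = (\<Sum>h\<in>UNIV. z h * (if y = d h then 1 else 0))" for z y
    by (simp add: d lin_ext_apply bas_apply)
  have X_apply: "X (bas (x, h)) (a, y) = b h a * \<Gamma> (x - A a) (y - d h)" for x h a y
  proof -
    have "hmul grp_alg (\<gamma> (bas t)) (\<delta> (bas h)) y = \<Gamma> t (y - d h)" for t
      by (simp add: grp_alg_mul_apply d lin_ext_bas bas_apply minus_add_eq_iff \<Gamma>_def
          if_mult_0 cong: if_cong)
    moreover have "(t + s = x) = (t = x - s)" for t s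
      by (metis add_diff_cancel diff_add_cancel)
    ultimately show ?thesis
      by (simp add: bas_pair X' lin_ext_apply sum_UNIV_prod fun_co_comul_apply tensor_apply A
          \<beta>_apply bas_apply sum_delta_mult if_mult_0 sum_if_0 cong: if_cong)
  qed
  show ?thesis
    by (rule that[OF \<alpha>_apply A0 \<beta>_apply _ b0 \<gamma>_apply \<Gamma>_central \<Gamma>_merge \<Gamma>_counit \<delta>_apply d(1) X_apply])
      (simp_all add: b(2))
qed

text \<open>
  All four components of \<open>(X \<otimes> X)(R)\<close> are sums of this form, for particular \<open>f\<close>, \<open>q\<close>, \<open>g\<close>, \<open>s\<close>.
  The new summation variables are the arguments of \<open>\<Gamma>\<close> (twice) and of \<open>P\<close> in the products of
  matrix entries.
\<close>
lemma transported_pairing: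
  fixes X :: "('g::{finite,group_add} \<times> 'g \<Rightarrow> 'k::field) \<Rightarrow> ('g \<times> 'g \<Rightarrow> 'k)"
  assumes R: "\<And>g y s z. R ((g, y), (s, z)) = r g s * P (y - \<mu> s) (z - \<nu> g)"
    and X: "\<And>x h a y. X (bas (x, h)) (a, y) = b h a * \<Gamma> (x - A a) (y - d h)"
  shows "(\<Sum>y\<in>UNIV. \<Sum>z\<in>UNIV. f y * q z * tensor_map X X R ((g, y), (s, z))) =
    kern_sum \<Gamma> (\<lambda>x w. kern_sum \<Gamma> (\<lambda>x' w'. kern_sum P (\<lambda>e c. r (x + A g) (x' + A s) *
      b (e + \<mu> (x' + A s)) g * b (c + \<nu> (x + A g)) s *
      f (w + d (e + \<mu> (x' + A s))) * q (w' + d (c + \<nu> (x + A g))))))" (is "?L = ?E")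
proof -
  have "?L = (\<Sum>(y, z, x, h, x', h')\<in>UNIV. f y * q z * (r x x' * P (h - \<mu> x') (h' - \<nu> x) *
      (b h g * \<Gamma> (x - A g) (y - d h) * (b h' s * \<Gamma> (x' - A s) (z - d h')))))"
    by (simp add: tensor_map_apply sum_UNIV_prod R X sum_distrib_left)
  also have "\<dots> = (\<Sum>(x, w, x', w', e, c)\<in>UNIV. \<Gamma> x w * (\<Gamma> x' w' * (P e c * (r (x + A g) (x' + A s) *
      b (e + \<mu> (x' + A s)) g * b (c + \<nu> (x + A g)) s *
      f (w + d (e + \<mu> (x' + A s))) * q (w' + d (c + \<nu> (x + A g)))))))"
    by (rule sum.reindex_bij_witness[where
          j = "\<lambda>(y, z, x, h, x', h'). (x - A g, y - d h, x' - A s, z - d h', h - \<mu> x', h' - \<nu> x)" and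
          i = "\<lambda>(x, w, x', w', e, c). (w + d (e + \<mu> (x' + A s)), w' + d (c + \<nu> (x + A g)), x + A g,
            e + \<mu> (x' + A s), x' + A s, c + \<nu> (x + A g))"])
      (auto simp: mult_ac)
  also have "\<dots> = ?E"
    by (simp add: kern_sum_def sum_UNIV_prod sum_distrib_left)
  finally show ?thesis .
qed

lemma is_linear_o: "is_linear \<phi> \<Longrightarrow> is_linear \<psi> \<Longrightarrow> is_linear (\<phi> \<circ> \<psi>)"
  for \<psi> :: "('a::finite \<Rightarrow> 'k::field) \<Rightarrow> ('b::finite \<Rightarrow> 'k)"
    and \<phi> :: "('b \<Rightarrow> 'k) \<Rightarrow> ('c \<Rightarrow> 'k)"
  unfolding comp_def by (rule is_linear_comp)

lemma is_linear_lin_transpose: "is_linear (lin_transpose M)"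
  by (rule is_linearI[where \<phi>' = "\<lambda>c b. M (bas b) c"]) (simp add: lin_transpose_def)

lemma is_linear_pullback: "is_linear \<phi>" if "\<And>f s. \<phi> f s = f (m s)"
  for \<phi> :: "('b::finite \<Rightarrow> 'k::field) \<Rightarrow> ('c \<Rightarrow> 'k)"
  by (rule is_linearI[where \<phi>' = "\<lambda>b s. bas b (m s)"]) (simp add: that bas_apply sum_delta_mult)

text \<open>
  The factors \<open>1\<close> bring all four sums into the form of \<open>transported_pairing\<close>.
\<close>
lemma component_sums:
  "id_eps (F_map R (f \<sharp> bas 0)) s = (\<Sum>y\<in>UNIV. \<Sum>z\<in>UNIV. f y * 1 * R ((0, y), (s, z)))"
  "id_eps (F_map R (1 \<sharp> a)) s = (\<Sum>g\<in>UNIV. a g * (\<Sum>y\<in>UNIV. \<Sum>z\<in>UNIV. 1 * 1 * R ((g, y), (s, z))))"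
  "ev1_id (F_map R (f \<sharp> bas 0)) z = (\<Sum>y\<in>UNIV. \<Sum>z'\<in>UNIV. f y * bas z z' * R ((0, y), (0, z')))"
  "ev1_id (F_map R (1 \<sharp> a)) z =
    (\<Sum>g\<in>UNIV. a g * (\<Sum>y\<in>UNIV. \<Sum>z'\<in>UNIV. 1 * bas z z' * R ((g, y), (0, z'))))"
proof -
  show "id_eps (F_map R (f \<sharp> bas 0)) s = (\<Sum>y\<in>UNIV. \<Sum>z\<in>UNIV. f y * 1 * R ((0, y), (s, z)))"
    by (simp add: id_eps_def F_map_def sum_UNIV_prod hash_def bas_apply if_mult_0 sum_if_0
        cong: if_cong) (rule sum.swap)
  have "id_eps (F_map R (1 \<sharp> a)) s =
      (\<Sum>z\<in>UNIV. \<Sum>g\<in>UNIV. \<Sum>y\<in>UNIV. a g * R ((g, y), (s, z)))"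
    by (simp add: id_eps_def F_map_def sum_UNIV_prod hash_def)
  also have "\<dots> = (\<Sum>g\<in>UNIV. \<Sum>y\<in>UNIV. \<Sum>z\<in>UNIV. a g * R ((g, y), (s, z)))"
    by (rule sum_rotate)
  finally show "id_eps (F_map R (1 \<sharp> a)) s =
      (\<Sum>g\<in>UNIV. a g * (\<Sum>y\<in>UNIV. \<Sum>z\<in>UNIV. 1 * 1 * R ((g, y), (s, z))))"
    by (simp add: sum_distrib_left)
  show "ev1_id (F_map R (f \<sharp> bas 0)) z =
      (\<Sum>y\<in>UNIV. \<Sum>z'\<in>UNIV. f y * bas z z' * R ((0, y), (0, z')))"
    by (simp add: ev1_id_def F_map_def sum_UNIV_prod hash_def bas_apply if_mult_0 sum_if_0
        cong: if_cong)
  show "ev1_id (F_map R (1 \<sharp> a)) z =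
      (\<Sum>g\<in>UNIV. a g * (\<Sum>y\<in>UNIV. \<Sum>z'\<in>UNIV. 1 * bas z z' * R ((g, y), (0, z'))))"
    by (simp add: ev1_id_def F_map_def sum_UNIV_prod hash_def bas_apply if_mult_0
        sum_distrib_left cong: if_cong)
qed

text \<open>
  The fourfold convolutions are unfolded into nested pairings. Where \<open>\<Gamma>\<close> occurs repeatedly, the
  arguments from its support are moved past the others by centrality, and pairs of \<open>\<Gamma>\<close> are
  merged. The result is \<open>transported_pairing\<close> after the sums over \<open>\<Gamma>\<close> in which only the counit
  is left have collapsed. For \<open>r\<close> and \<open>v\<close> the argument is a group element \<open>g\<close>, which is grouplike,
  so that convolution is a product; there linearity reduces the claim to such arguments.
\<close>
lemma transported_components:
  fixes R :: "('g::{finite,group_add} \<times> 'g) \<times> ('g \<times> 'g) \<Rightarrow> 'k::field"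
  assumes R: "component_form R \<mu> r0 P \<nu>" and comp: "components R = (u, r, p, v)"
    and X: "has_matrix X \<alpha> \<beta> \<gamma> \<delta>"
  shows "components (tensor_map X X R) =
    ((\<alpha> \<circ> r \<circ> lin_transpose \<gamma> \<boxplus>\<^bsub>fun_co,fun_co\<^esub> \<alpha> \<circ> u \<circ> lin_transpose \<delta>
       \<boxplus>\<^bsub>fun_co,fun_co\<^esub> \<beta> \<circ> p \<circ> lin_transpose \<delta> \<boxplus>\<^bsub>fun_co,fun_co\<^esub> \<beta> \<circ> v \<circ> lin_transpose \<gamma>),
     (\<alpha> \<circ> r \<circ> lin_transpose \<alpha> \<boxplus>\<^bsub>grp_alg,fun_co\<^esub> \<alpha> \<circ> u \<circ> lin_transpose \<beta>
       \<boxplus>\<^bsub>grp_alg,fun_co\<^esub> \<beta> \<circ> p \<circ> lin_transpose \<beta> \<boxplus>\<^bsub>grp_alg,fun_co\<^esub> \<beta> \<circ> v \<circ> lin_transpose \<alpha>),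
     (\<gamma> \<circ> r \<circ> lin_transpose \<gamma> \<boxplus>\<^bsub>fun_co,grp_alg\<^esub> \<gamma> \<circ> u \<circ> lin_transpose \<delta>
       \<boxplus>\<^bsub>fun_co,grp_alg\<^esub> \<delta> \<circ> p \<circ> lin_transpose \<delta> \<boxplus>\<^bsub>fun_co,grp_alg\<^esub> \<delta> \<circ> v \<circ> lin_transpose \<gamma>),
     (\<gamma> \<circ> r \<circ> lin_transpose \<alpha> \<boxplus>\<^bsub>grp_alg,grp_alg\<^esub> \<gamma> \<circ> u \<circ> lin_transpose \<beta>
       \<boxplus>\<^bsub>grp_alg,grp_alg\<^esub> \<delta> \<circ> p \<circ> lin_transpose \<beta> \<boxplus>\<^bsub>grp_alg,grp_alg\<^esub> \<delta> \<circ> v \<circ> lin_transpose \<alpha>))"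
    (is "components ?R = (?u, ?r, ?p, ?v)")
proof -
  obtain A :: "'g \<Rightarrow> 'g" and b \<Gamma> :: "'g \<Rightarrow> 'g \<Rightarrow> 'k" and d :: "'g \<Rightarrow> 'g" where
    \<alpha>: "\<And>f s. \<alpha> f s = f (A s)" and A0: "A 0 = 0" and
    \<beta>: "\<And>z s. \<beta> z s = (\<Sum>h\<in>UNIV. z h * b h s)" and
    b_add: "\<And>h h' s. b (h + h') s = b h s * b h' s" and b0: "\<And>h. b h 0 = 1" and
    \<gamma>: "\<And>f y. \<gamma> f y = (\<Sum>x\<in>UNIV. f x * \<Gamma> x y)" and
    \<Gamma>_central: "\<And>x y. \<Gamma> x y \<noteq> 0 \<Longrightarrow> central x \<and> central y" and
    \<Gamma>_merge: "\<And>x x' w. (\<Sum>c\<in>UNIV. \<Gamma> x c * \<Gamma> x' (- c + w)) = (if x = x' then \<Gamma> x w else 0)" and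
    \<Gamma>_counit: "\<And>x. (\<Sum>y\<in>UNIV. \<Gamma> x y) = (if x = 0 then 1 else 0)" and
    \<delta>: "\<And>z y. \<delta> z y = (\<Sum>h\<in>UNIV. z h * (if y = d h then 1 else 0))" and
    d_add: "\<And>h h'. d (h + h') = d h + d h'" and
    X_bas: "\<And>x h a y. X (bas (x, h)) (a, y) = b h a * \<Gamma> (x - A a) (y - d h)"
    by (rule has_matrix_coordinates[OF X]) blast
  have u: "u f s = f (\<mu> s)" and r: "r z s = (\<Sum>g\<in>UNIV. z g * r0 g s)"
    and p: "p f h = (\<Sum>y\<in>UNIV. f y * P y h)"
    and v: "v z h = (\<Sum>g\<in>UNIV. z g * (if h = \<nu> g then 1 else 0))" for f z s h
    using comp component_form_components[OF R] by auto
  have R_shape: "\<And>g y s z. R ((g, y), (s, z)) = r0 g s * P (y - \<mu> s) (z - \<nu> g)"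
    and \<mu>0: "\<mu> 0 = 0" and \<nu>0: "\<nu> 0 = 0"
    using R by (simp_all add: component_form_def)
  note pairing = transported_pairing[where R = R and X = X, OF R_shape X_bas]
  note collapse = kern_sum_counit[OF \<Gamma>_counit]
  note merge = kern_sum_merge[OF \<Gamma>_merge]

  have \<gamma>T: "lin_transpose \<gamma> f x = (\<Sum>w\<in>UNIV. f w * \<Gamma> x w)" for f x
    by (simp add: lin_transpose_def \<gamma> bas_apply sum_delta_mult)
  have \<delta>T: "lin_transpose \<delta> f h = f (d h)" for f h
    by (simp add: lin_transpose_def \<delta> bas_apply sum_delta_mult)
  have \<alpha>T: "lin_transpose \<alpha> (bas g) a = bas (A g) a" for g a
    by (auto simp: lin_transpose_def \<alpha> bas_apply sum_delta_mult)
  have \<beta>T: "lin_transpose \<beta> (bas g) h = b h g" for g h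
    by (simp add: lin_transpose_def \<beta> bas_apply sum_delta_mult)
  have lin: "is_linear \<alpha>" "is_linear \<beta>" "is_linear \<gamma>" "is_linear \<delta>"
    "is_linear u" "is_linear r" "is_linear p" "is_linear v"
    by (rule is_linear_pullback[OF \<alpha>] is_linear_pullback[OF u] is_linearI[OF \<beta>] is_linearI[OF \<gamma>]
        is_linearI[OF \<delta>] is_linearI[OF r] is_linearI[OF p] is_linearI[OF v])+
  note lins = lin is_linear_o is_linear_lin_transpose is_linear_convolutions

  have u_eq: "id_eps (F_map ?R (f \<sharp> bas 0)) s = ?u f s" for f s
  proof -
    have 1: "(\<alpha> \<circ> r \<circ> lin_transpose \<gamma>) f s = kern_sum \<Gamma> (\<lambda>x w. f w * r0 x (A s))" for f
      by (simp add: \<alpha> r \<gamma>T kern_sum_def sum_distrib_left sum_distrib_right mult_ac)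
    have 2: "(\<alpha> \<circ> u \<circ> lin_transpose \<delta>) f s = f (d (\<mu> (A s)))" for f
      by (simp add: \<alpha> u \<delta>T)
    have 3: "(\<beta> \<circ> p \<circ> lin_transpose \<delta>) f s = kern_sum P (\<lambda>e c. f (d e) * b c s)" for f
      by (simp add: \<beta> p \<delta>T kern_sum_def sum_distrib_left sum_distrib_right, subst sum.swap) (simp add: mult_ac)
    have 4: "(\<beta> \<circ> v \<circ> lin_transpose \<gamma>) f s = kern_sum \<Gamma> (\<lambda>x w. f w * b (\<nu> x) s)" for f
      by (simp add: \<beta> v \<gamma>T kern_sum_def sum_distrib_left sum_distrib_right, subst sum.swap)
        (simp add: if_mult_0 sum_if_0 mult_ac cong: if_cong)
    have "?u f s = kern_sum \<Gamma> (\<lambda>x w. kern_sum P (\<lambda>e c. kern_sum \<Gamma> (\<lambda>x' w'.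
        f (w + (d e + (d (\<mu> (A s)) + w'))) * r0 x' (A s) * b c s * b (\<nu> x) s)))"
      by (simp only: convolution_fun_fun lins 1 2 3 4 kern_sum_mult)
    also have "\<dots> = kern_sum \<Gamma> (\<lambda>x w. kern_sum \<Gamma> (\<lambda>x' w'. kern_sum P (\<lambda>e c.
        f (w + (d e + (d (\<mu> (A s)) + w'))) * r0 x' (A s) * b c s * b (\<nu> x) s)))"
      by (simp only: kern_sum_swap[of P])
    also have "\<dots> = kern_sum \<Gamma> (\<lambda>x w. kern_sum \<Gamma> (\<lambda>x' w'. kern_sum P (\<lambda>e c.
        f ((w + w') + d (e + \<mu> (A s))) * r0 x' (A s) * b c s * b (\<nu> x) s)))"
    proof (intro kern_sum_cong)
      fix x w x' w' e c
      assume "\<Gamma> x' w' \<noteq> 0"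
      then have "w + (d e + (d (\<mu> (A s)) + w')) = (w + w') + d (e + \<mu> (A s))"
        using \<Gamma>_central[of x' w'] by (metis add.assoc central_def d_add)
      then show "f (w + (d e + (d (\<mu> (A s)) + w'))) * r0 x' (A s) * b c s * b (\<nu> x) s =
          f ((w + w') + d (e + \<mu> (A s))) * r0 x' (A s) * b c s * b (\<nu> x) s"
        by simp
    qed
    also have "\<dots> = kern_sum \<Gamma> (\<lambda>x w. kern_sum P (\<lambda>e c.
        f (w + d (e + \<mu> (A s))) * r0 x (A s) * b c s * b (\<nu> x) s))"
      by (rule merge)
    also have "\<dots> = id_eps (F_map ?R (f \<sharp> bas 0)) s"
      unfolding component_sums pairing by (subst collapse) (simp add: A0 b0 b_add mult_ac)
    finally show ?thesis ..
  qed

  have r_eq: "id_eps (F_map ?R (1 \<sharp> a)) s = ?r a s" for a s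
  proof -
    have 1: "(\<alpha> \<circ> r \<circ> lin_transpose \<alpha>) (bas g) s = r0 (A g) (A s)" for g
      by (simp add: \<alpha> r \<alpha>T bas_apply sum_delta_mult)
    have 2: "(\<alpha> \<circ> u \<circ> lin_transpose \<beta>) (bas g) s = b (\<mu> (A s)) g" for g
      by (simp add: \<alpha> u \<beta>T)
    have 3: "(\<beta> \<circ> p \<circ> lin_transpose \<beta>) (bas g) s = kern_sum P (\<lambda>e c. b e g * b c s)" for g
      by (simp add: \<beta> p \<beta>T kern_sum_def sum_distrib_left sum_distrib_right, subst sum.swap) (simp add: mult_ac)
    have 4: "(\<beta> \<circ> v \<circ> lin_transpose \<alpha>) (bas g) s = b (\<nu> (A g)) s" for g
      by (simp add: \<beta> v \<alpha>T bas_apply sum_delta_mult)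
    have "?r (bas g) s = (\<Sum>y\<in>UNIV. \<Sum>z\<in>UNIV. 1 * 1 * ?R ((g, y), (s, z)))" for g
    proof -
      have "?r (bas g) s = kern_sum P (\<lambda>e c. r0 (A g) (A s) * b (\<mu> (A s)) g * (b e g * b c s) *
          b (\<nu> (A g)) s)"
        unfolding convolution_grp_bas
        by (simp add: fun_co_def 1 2 3 4 kern_sum_mult del: comp_apply)
      also have "\<dots> = (\<Sum>y\<in>UNIV. \<Sum>z\<in>UNIV. 1 * 1 * ?R ((g, y), (s, z)))"
        unfolding pairing by (subst collapse, subst collapse) (simp add: b_add mult_ac)
      finally show ?thesis .
    qed
    note on_bas = this
    have "?r a s = (\<Sum>g\<in>UNIV. a g * ?r (bas g) s)"
      by (rule linear_apply) (rule lins)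
    then show ?thesis by (simp only: on_bas component_sums)
  qed

  have p_eq: "ev1_id (F_map ?R (f \<sharp> bas 0)) z = ?p f z" for f z
  proof -
    let ?t = "\<lambda>a z'. f a * bas z z'"
    have 1: "kern_sum (\<lambda>a z. (\<gamma> \<circ> r \<circ> lin_transpose \<gamma>) (bas a) z) t =
        kern_sum \<Gamma> (\<lambda>x w. kern_sum \<Gamma> (\<lambda>x' w'. r0 x x' * t w w'))" for t
    proof -
      have "kern_sum (\<lambda>a z. (\<gamma> \<circ> r \<circ> lin_transpose \<gamma>) (bas a) z) t =
          (\<Sum>w\<in>UNIV. \<Sum>w'\<in>UNIV. \<Sum>x'\<in>UNIV. \<Sum>x\<in>UNIV. \<Gamma> x w * (\<Gamma> x' w' * (r0 x x' * t w w')))"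
        by (simp add: kern_sum_def \<gamma> r \<gamma>T bas_apply sum_delta_mult sum_distrib_left sum_distrib_right mult_ac)
      also have "\<dots> = (\<Sum>w\<in>UNIV. \<Sum>w'\<in>UNIV. \<Sum>x\<in>UNIV. \<Sum>x'\<in>UNIV. \<Gamma> x w * (\<Gamma> x' w' * (r0 x x' * t w w')))"
        by (intro sum.cong refl sum.swap)
      also have "\<dots> = (\<Sum>w\<in>UNIV. \<Sum>x\<in>UNIV. \<Sum>x'\<in>UNIV. \<Sum>w'\<in>UNIV. \<Gamma> x w * (\<Gamma> x' w' * (r0 x x' * t w w')))"
        by (intro sum.cong refl sum_rotate)
      also have "\<dots> = kern_sum \<Gamma> (\<lambda>x w. kern_sum \<Gamma> (\<lambda>x' w'. r0 x x' * t w w'))"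
        by (subst sum.swap) (simp add: kern_sum_def sum_distrib_left)
      finally show ?thesis .
    qed
    have 2: "kern_sum (\<lambda>a z. (\<gamma> \<circ> u \<circ> lin_transpose \<delta>) (bas a) z) t =
        kern_sum \<Gamma> (\<lambda>x w. t (d (\<mu> x)) w)" for t
    proof -
      have "kern_sum (\<lambda>a z. (\<gamma> \<circ> u \<circ> lin_transpose \<delta>) (bas a) z) t =
          (\<Sum>a\<in>UNIV. \<Sum>w\<in>UNIV. \<Sum>x\<in>UNIV. (if d (\<mu> x) = a then 1 else 0) * \<Gamma> x w * t a w)"
        by (simp add: kern_sum_def \<gamma> u \<delta>T bas_apply sum_distrib_right)
      also have "\<dots> = (\<Sum>w\<in>UNIV. \<Sum>x\<in>UNIV. \<Sum>a\<in>UNIV. (if d (\<mu> x) = a then 1 else 0) * \<Gamma> x w * t a w)"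
        by (rule sum_rotate)
      also have "\<dots> = (\<Sum>w\<in>UNIV. \<Sum>x\<in>UNIV. \<Gamma> x w * t (d (\<mu> x)) w)"
        by (simp add: if_mult_0 cong: if_cong)
      finally show ?thesis
        unfolding kern_sum_def by (subst sum.swap)
    qed
    have 3: "kern_sum (\<lambda>a z. (\<delta> \<circ> p \<circ> lin_transpose \<delta>) (bas a) z) t =
        kern_sum P (\<lambda>e c. t (d e) (d c))" for t
    proof -
      have "kern_sum (\<lambda>a z. (\<delta> \<circ> p \<circ> lin_transpose \<delta>) (bas a) z) t =
          (\<Sum>a\<in>UNIV. \<Sum>w\<in>UNIV. \<Sum>c\<in>UNIV. \<Sum>e\<in>UNIV.
            (if d e = a then 1 else 0) * P e c * (if w = d c then 1 else 0) * t a w)"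
        by (simp add: kern_sum_def \<delta> p \<delta>T bas_apply sum_distrib_right)
      also have "\<dots> = (\<Sum>a\<in>UNIV. \<Sum>c\<in>UNIV. \<Sum>e\<in>UNIV. \<Sum>w\<in>UNIV.
            (if d e = a then 1 else 0) * P e c * (if w = d c then 1 else 0) * t a w)"
        by (intro sum.cong refl sum_rotate)
      also have "\<dots> = (\<Sum>c\<in>UNIV. \<Sum>e\<in>UNIV. \<Sum>a\<in>UNIV. \<Sum>w\<in>UNIV.
            (if d e = a then 1 else 0) * P e c * (if w = d c then 1 else 0) * t a w)"
        by (rule sum_rotate)
      also have "\<dots> = (\<Sum>c\<in>UNIV. \<Sum>e\<in>UNIV. P e c * t (d e) (d c))"
        by (simp add: if_mult_0 sum_if_0 cong: if_cong)
      finally show ?thesis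
        unfolding kern_sum_def by (subst sum.swap)
    qed
    have 4: "kern_sum (\<lambda>a z. (\<delta> \<circ> v \<circ> lin_transpose \<gamma>) (bas a) z) t =
        kern_sum \<Gamma> (\<lambda>x w. t w (d (\<nu> x)))" for t
    proof -
      have "kern_sum (\<lambda>a z. (\<delta> \<circ> v \<circ> lin_transpose \<gamma>) (bas a) z) t =
          (\<Sum>a\<in>UNIV. \<Sum>w\<in>UNIV. \<Sum>h\<in>UNIV. \<Sum>x\<in>UNIV.
            \<Gamma> x a * (if h = \<nu> x then 1 else 0) * (if w = d h then 1 else 0) * t a w)"
        by (simp add: kern_sum_def \<delta> v \<gamma>T bas_apply sum_delta_mult sum_distrib_right)
      also have "\<dots> = (\<Sum>a\<in>UNIV. \<Sum>h\<in>UNIV. \<Sum>x\<in>UNIV. \<Sum>w\<in>UNIV.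
            \<Gamma> x a * (if h = \<nu> x then 1 else 0) * (if w = d h then 1 else 0) * t a w)"
        by (intro sum.cong refl sum_rotate)
      also have "\<dots> = (\<Sum>a\<in>UNIV. \<Sum>x\<in>UNIV. \<Sum>h\<in>UNIV. \<Sum>w\<in>UNIV.
            \<Gamma> x a * (if h = \<nu> x then 1 else 0) * (if w = d h then 1 else 0) * t a w)"
        by (intro sum.cong refl sum.swap)
      also have "\<dots> = (\<Sum>a\<in>UNIV. \<Sum>x\<in>UNIV. \<Gamma> x a * t a (d (\<nu> x)))"
        by (simp add: if_mult_0 sum_if_0 cong: if_cong)
      finally show ?thesis
        unfolding kern_sum_def by (subst sum.swap)
    qed
    have "?p f z = kern_sum (\<lambda>a z. ?p (bas a) z) ?t"
      by (rule kern_sum_apply[symmetric]) (rule lins)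
    also have "\<dots> = kern_sum \<Gamma> (\<lambda>x w. kern_sum P (\<lambda>e c. kern_sum \<Gamma> (\<lambda>x2 w2.
        kern_sum \<Gamma> (\<lambda>x1 w1. kern_sum \<Gamma> (\<lambda>x1' w1'. r0 x1 x1' *
          ?t (w + (d e + (d (\<mu> x2) + w1))) (w1' + w2 + d c + d (\<nu> x)))))))"
      by (simp only: convolution_fun_grp 1 2 3 4)
    also have "\<dots> = kern_sum \<Gamma> (\<lambda>x w. kern_sum \<Gamma> (\<lambda>x1 w1. kern_sum \<Gamma> (\<lambda>x2 w2.
        kern_sum \<Gamma> (\<lambda>x1' w1'. kern_sum P (\<lambda>e c. r0 x1 x1' *
          ?t (w + (d e + (d (\<mu> x2) + w1))) (w1' + w2 + d c + d (\<nu> x)))))))"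
      by (simp only: kern_sum_swap[of P])
        (rule kern_sum_cong, rule kern_sum_swap)
    also have "\<dots> = kern_sum \<Gamma> (\<lambda>x w. kern_sum \<Gamma> (\<lambda>x1 w1. kern_sum \<Gamma> (\<lambda>x2 w2.
        kern_sum \<Gamma> (\<lambda>x1' w1'. kern_sum P (\<lambda>e c. r0 x1 x1' *
          ?t ((w + w1) + d (e + \<mu> x2)) ((w2 + w1') + d (c + \<nu> x)))))))"
    proof (intro kern_sum_cong)
      fix x w x1 w1 x2 w2 x1' w1' e c
      assume nz: "\<Gamma> x1 w1 \<noteq> 0" "\<Gamma> x2 w2 \<noteq> 0"
      have "w + (d e + (d (\<mu> x2) + w1)) = (w + w1) + d (e + \<mu> x2)"
        using \<Gamma>_central[OF nz(1)] by (metis add.assoc central_def d_add)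
      moreover have "w1' + w2 + d c + d (\<nu> x) = (w2 + w1') + d (c + \<nu> x)"
        using \<Gamma>_central[OF nz(2)] by (metis add.assoc central_def d_add)
      ultimately show "r0 x1 x1' * ?t (w + (d e + (d (\<mu> x2) + w1))) (w1' + w2 + d c + d (\<nu> x)) =
          r0 x1 x1' * ?t ((w + w1) + d (e + \<mu> x2)) ((w2 + w1') + d (c + \<nu> x))"
        by simp
    qed
    also have "\<dots> = kern_sum \<Gamma> (\<lambda>x w. kern_sum \<Gamma> (\<lambda>x2 w2. kern_sum \<Gamma> (\<lambda>x1' w1'.
        kern_sum P (\<lambda>e c. r0 x x1' *
          ?t (w + d (e + \<mu> x2)) ((w2 + w1') + d (c + \<nu> x))))))"
      by (rule merge)
    also have "\<dots> = kern_sum \<Gamma> (\<lambda>x w. kern_sum \<Gamma> (\<lambda>x' w'. kern_sum P (\<lambda>e c. r0 x x' *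
          ?t (w + d (e + \<mu> x')) (w' + d (c + \<nu> x)))))"
      by (rule kern_sum_cong, rule merge)
    also have "\<dots> = ev1_id (F_map ?R (f \<sharp> bas 0)) z"
      unfolding component_sums pairing by (simp add: A0 b0 mult_ac)
    finally show ?thesis ..
  qed

  have v_eq: "ev1_id (F_map ?R (1 \<sharp> a)) z = ?v a z" for a z
  proof -
    have 1: "(\<Sum>y\<in>UNIV. (\<gamma> \<circ> r \<circ> lin_transpose \<alpha>) (bas g) y * q y) =
        kern_sum \<Gamma> (\<lambda>x w. r0 (A g) x * q w)" for g q
      by (simp add: \<gamma> r \<alpha>T bas_apply sum_delta_mult kern_sum_def sum_distrib_left sum_distrib_right, subst sum.swap)
        (simp add: mult_ac)
    have 2: "(\<Sum>y\<in>UNIV. (\<gamma> \<circ> u \<circ> lin_transpose \<beta>) (bas g) y * q y) =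
        kern_sum \<Gamma> (\<lambda>x w. b (\<mu> x) g * q w)" for g q
      by (simp add: \<gamma> u \<beta>T kern_sum_def sum_distrib_left sum_distrib_right, subst sum.swap)
        (simp add: mult_ac)
    have 3: "(\<Sum>y\<in>UNIV. (\<delta> \<circ> p \<circ> lin_transpose \<beta>) (bas g) y * q y) =
        kern_sum P (\<lambda>e c. b e g * q (d c))" for g q
    proof -
      have "(\<Sum>y\<in>UNIV. (\<delta> \<circ> p \<circ> lin_transpose \<beta>) (bas g) y * q y) =
          (\<Sum>y\<in>UNIV. \<Sum>c\<in>UNIV. \<Sum>e\<in>UNIV. b e g * P e c * (if y = d c then 1 else 0) * q y)"
        by (simp add: \<delta> p \<beta>T sum_distrib_right)
      also have "\<dots> = (\<Sum>c\<in>UNIV. \<Sum>e\<in>UNIV. \<Sum>y\<in>UNIV. b e g * P e c * (if y = d c then 1 else 0) * q y)"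
        by (rule sum_rotate)
      also have "\<dots> = (\<Sum>c\<in>UNIV. \<Sum>e\<in>UNIV. P e c * (b e g * q (d c)))"
        by (simp add: if_mult_0 mult_ac cong: if_cong)
      finally show ?thesis
        unfolding kern_sum_def by (subst sum.swap)
    qed
    have 4: "(\<Sum>y\<in>UNIV. (\<delta> \<circ> v \<circ> lin_transpose \<alpha>) (bas g) y * q y) = q (d (\<nu> (A g)))" for g q
      by (simp add: \<delta> v \<alpha>T bas_apply sum_delta_mult)
    have "?v (bas g) z = (\<Sum>y\<in>UNIV. \<Sum>z'\<in>UNIV. 1 * bas z z' * ?R ((g, y), (0, z')))" for g
    proof -
      have "?v (bas g) z = (\<Sum>y\<in>UNIV. ?v (bas g) y * bas z y)"
        by (simp add: bas_apply sum_delta_mult)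
      also have "\<dots> = kern_sum P (\<lambda>e c. b e g * kern_sum \<Gamma> (\<lambda>x w. b (\<mu> x) g *
          kern_sum \<Gamma> (\<lambda>x' w'. r0 (A g) x' * bas z (w' + w + d c + d (\<nu> (A g))))))"
        by (simp only: convolution_grp_bas grp_alg_mul_pairing 1 2 3 4)
      also have "\<dots> = kern_sum \<Gamma> (\<lambda>x w. kern_sum \<Gamma> (\<lambda>x' w'. kern_sum P (\<lambda>e c. b e g * (b (\<mu> x) g *
          (r0 (A g) x' * bas z (w' + w + d c + d (\<nu> (A g))))))))"
        by (simp only: kern_sum_mult kern_sum_swap[of P])
      also have "\<dots> = kern_sum \<Gamma> (\<lambda>x w. kern_sum \<Gamma> (\<lambda>x' w'. kern_sum P (\<lambda>e c. b e g * (b (\<mu> x) g *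
          (r0 (A g) x' * bas z ((w + w') + d (c + \<nu> (A g))))))))"
      proof (intro kern_sum_cong)
        fix x w x' w' e c
        assume "\<Gamma> x w \<noteq> 0"
        then have "w' + w + d c + d (\<nu> (A g)) = (w + w') + d (c + \<nu> (A g))"
          using \<Gamma>_central[of x w] by (metis add.assoc central_def d_add)
        then show "b e g * (b (\<mu> x) g * (r0 (A g) x' * bas z (w' + w + d c + d (\<nu> (A g))))) =
            b e g * (b (\<mu> x) g * (r0 (A g) x' * bas z ((w + w') + d (c + \<nu> (A g)))))"
          by simp
      qed
      also have "\<dots> = kern_sum \<Gamma> (\<lambda>x w. kern_sum P (\<lambda>e c. b e g * (b (\<mu> x) g *
          (r0 (A g) x * bas z (w + d (c + \<nu> (A g)))))))"
        by (rule merge)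
      also have "\<dots> = (\<Sum>y\<in>UNIV. \<Sum>z'\<in>UNIV. 1 * bas z z' * ?R ((g, y), (0, z')))"
        unfolding pairing by (subst collapse) (simp add: A0 b0 b_add mult_ac)
      finally show ?thesis .
    qed
    note on_bas = this
    have "?v a z = (\<Sum>g\<in>UNIV. a g * ?v (bas g) z)"
      by (rule linear_apply) (rule lins)
    then show ?thesis by (simp only: on_bas component_sums)
  qed
  show ?thesis
    by (simp only: components_def prod.inject fun_eq_iff u_eq r_eq p_eq v_eq simp_thms)
qed


theorem theorem7p6:
  fixes R R' :: "('g::{finite,group_add} \<times> 'g) \<times> ('g \<times> 'g) \<Rightarrow> 'k::field"
    and X :: "('g \<times> 'g \<Rightarrow> 'k) \<Rightarrow> ('g \<times> 'g \<Rightarrow> 'k)"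
    and u r p v u' r' p' v' \<alpha> \<beta> \<gamma> \<delta> :: "('g \<Rightarrow> 'k) \<Rightarrow> ('g \<Rightarrow> 'k)"
  assumes "quasitriangular double R" and "components R = (u, r, p, v)"
    and "quasitriangular double R'" and "components R' = (u', r', p', v')"
    and "hopf_aut double X" and "has_matrix X \<alpha> \<beta> \<gamma> \<delta>"
  shows "(tensor_map X X R = R' \<longleftrightarrow> X \<circ> (F_map R \<circ> lin_transpose X) = F_map R') \<and>
    (X \<circ> (F_map R \<circ> lin_transpose X) = F_map R' \<longleftrightarrow>
      u' = (\<alpha> \<circ> r \<circ> lin_transpose \<gamma> \<boxplus>\<^bsub>fun_co,fun_co\<^esub> \<alpha> \<circ> u \<circ> lin_transpose \<delta>
             \<boxplus>\<^bsub>fun_co,fun_co\<^esub> \<beta> \<circ> p \<circ> lin_transpose \<delta> \<boxplus>\<^bsub>fun_co,fun_co\<^esub> \<beta> \<circ> v \<circ> lin_transpose \<gamma>) \<and>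
      r' = (\<alpha> \<circ> r \<circ> lin_transpose \<alpha> \<boxplus>\<^bsub>grp_alg,fun_co\<^esub> \<alpha> \<circ> u \<circ> lin_transpose \<beta>
             \<boxplus>\<^bsub>grp_alg,fun_co\<^esub> \<beta> \<circ> p \<circ> lin_transpose \<beta> \<boxplus>\<^bsub>grp_alg,fun_co\<^esub> \<beta> \<circ> v \<circ> lin_transpose \<alpha>) \<and>
      p' = (\<gamma> \<circ> r \<circ> lin_transpose \<gamma> \<boxplus>\<^bsub>fun_co,grp_alg\<^esub> \<gamma> \<circ> u \<circ> lin_transpose \<delta>
             \<boxplus>\<^bsub>fun_co,grp_alg\<^esub> \<delta> \<circ> p \<circ> lin_transpose \<delta> \<boxplus>\<^bsub>fun_co,grp_alg\<^esub> \<delta> \<circ> v \<circ> lin_transpose \<gamma>) \<and>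
      v' = (\<gamma> \<circ> r \<circ> lin_transpose \<alpha> \<boxplus>\<^bsub>grp_alg,grp_alg\<^esub> \<gamma> \<circ> u \<circ> lin_transpose \<beta>
             \<boxplus>\<^bsub>grp_alg,grp_alg\<^esub> \<delta> \<circ> p \<circ> lin_transpose \<beta> \<boxplus>\<^bsub>grp_alg,grp_alg\<^esub> \<delta> \<circ> v \<circ> lin_transpose \<alpha>))"
proof -
  let ?R = "tensor_map X X R"
  have X: "hopf_hom double double X" "surj X"
    using assms(5) by (simp_all add: hopf_aut_def bij_is_surj)
  have F: "X \<circ> (F_map R \<circ> lin_transpose X) = F_map R' \<longleftrightarrow> ?R = R'"
    by (simp only: F_map_tensor_map[OF hopf_homD(1)[OF X(1)], symmetric] F_map_inject)
  have "quasitriangular double ?R"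
    by (rule quasitriangular_hopf_hom[OF is_bilinear_double is_bilinear_double
          is_linear_double_comul double_counit X assms(1)])
  then have "?R = R' \<longleftrightarrow> components R' = components ?R"
    using components_determine[OF assms(3)] by auto
  moreover obtain \<mu> r0 P \<nu> where "component_form R \<mu> r0 P \<nu>"
    by (rule quasitriangular_double_component_form[OF assms(1)])
  note transported_components[OF this assms(2,6)]
  ultimately show ?thesis
    unfolding F assms(4) by (simp only: prod.inject simp_thms)
qed

end
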